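(* Let $V:\mathbb{Z}\to\mathbb{R}$ be bounded, let $H$ be the operator on $\ell^2(\mathbb{Z})$ given by $[H\psi](n)=\psi(n+1)+\psi(n-1)+V(n)\psi(n)$, and let $K\ge4$ be such that $\sigma(H)\subseteq[-K+1,K-1]$. Then there exist constants $C,c>0$ depending only on $K$ such that for all integers $N\ge1$ and all $T\ge1$, $$P_r(N,T)\le C\left(\exp(-cN)+T^3\int_{-K}^K\Big(\max_{1\le n\le N}\big\|\Phi\big(n,E+\tfrac iT\big)\big\|^2\Big)^{-1}dE\right),$$ $$P_l(N,T)\le C\left(\exp(-cN)+T^3\int_{-K}^K\Big(\max_{-N\le n\le -1}\big\|\Phi\big(n,E+\tfrac iT\big)\big\|^2\Big)^{-1}dE\right).$$
   Context: Let $(\delta_n)$ be the canonical basis of $\ell^2(\mathbb{Z})$. For $T>0$ let $a(n,T)=\frac{2}{T}\int_0^\infty e^{-2t/T}|\langle e^{-itH}\delta_1,\delta_n\rangle|^2\,dt$, $P_r(N,T)=\sum_{n>N}a(n,T)$ and $P_l(N,T)=\sum_{n<-N}a(n,T)$. Transfer matrices: for $z\in\mathbb{C}$, $m\in\mathbb{Z}$ put $T(m,z)=\begin{pmatrix} z-V(m)&-1\\1&0\end{pmatrix}$, and $\Phi(n,z)=T(n,z)\cdots T(1,z)$ for $n\ge1$, $\Phi(0,z)=\mathrm{Id}$, $\Phi(n,z)=[T(n+1,z)]^{-1}\cdots[T(0,z)]^{-1}$ for $n\le-1$. $\|\cdot\|$ is the operator norm. *)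

theory Defs
  imports "HOL-Analysis.Analysis"
begin

section \<open>The Hilbert space of square-summable two-sided complex sequences\<close>

typedef ell2 = "{f :: int \<Rightarrow> complex. (\<lambda>n. (cmod (f n))\<^sup>2) summable_on UNIV}"
  morphisms ell2_nth Abs_ell2
  by (rule exI[of _ "\<lambda>_. 0"]) simp

setup_lifting type_definition_ell2

lemma ell2_nth_summable: "(\<lambda>n. (cmod (ell2_nth f n))\<^sup>2) summable_on UNIV"
  using ell2_nth by simp

lemma cmod_add_square_le: "(cmod (a + b))\<^sup>2 \<le> 2 * (cmod a)\<^sup>2 + 2 * (cmod b)\<^sup>2"
proof -
  have "(cmod (a + b))\<^sup>2 \<le> (cmod a + cmod b)\<^sup>2"
    by (intro power_mono norm_triangle_ineq norm_ge_zero)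
  also have "\<dots> \<le> 2 * (cmod a)\<^sup>2 + 2 * (cmod b)\<^sup>2"
    using sum_squares_bound[of "cmod a" "cmod b"] by (simp add: power2_sum)
  finally show ?thesis .
qed

lemma square_summable_add:
  assumes "(\<lambda>n. (cmod (f n))\<^sup>2) summable_on A" "(\<lambda>n. (cmod (g n))\<^sup>2) summable_on A"
  shows "(\<lambda>n. (cmod (f n + g n))\<^sup>2) summable_on A"
proof (rule summable_on_comparison_test)
  show "(\<lambda>n. 2 * (cmod (f n))\<^sup>2 + 2 * (cmod (g n))\<^sup>2) summable_on A"
    by (intro summable_on_add summable_on_cmult_right assms)
qed (auto intro: cmod_add_square_le)

lemma square_summable_mult_bounded:
  assumes "(\<lambda>n. (cmod (f n))\<^sup>2) summable_on A" "\<And>n. n \<in> A \<Longrightarrow> cmod (g n) \<le> B"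
  shows "(\<lambda>n. (cmod (g n * f n))\<^sup>2) summable_on A"
proof (rule summable_on_comparison_test)
  show "(\<lambda>n. B\<^sup>2 * (cmod (f n))\<^sup>2) summable_on A"
    by (intro summable_on_cmult_right assms)
  fix n assume "n \<in> A"
  hence "(cmod (g n))\<^sup>2 \<le> B\<^sup>2"
    using assms(2) by (intro power_mono) auto
  thus "(cmod (g n * f n))\<^sup>2 \<le> B\<^sup>2 * (cmod (f n))\<^sup>2"
    by (auto simp: norm_mult power_mult_distrib intro!: mult_right_mono)
qed auto

lemma square_summable_cmult:
  assumes "(\<lambda>n. (cmod (f n))\<^sup>2) summable_on A"
  shows "(\<lambda>n. (cmod (c * f n))\<^sup>2) summable_on A"
  using square_summable_mult_bounded[OF assms, of "\<lambda>_. c" "cmod c"] by simp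

lemma square_summable_diff:
  assumes "(\<lambda>n. (cmod (f n))\<^sup>2) summable_on A" "(\<lambda>n. (cmod (g n))\<^sup>2) summable_on A"
  shows "(\<lambda>n. (cmod (f n - g n))\<^sup>2) summable_on A"
  using square_summable_add[of f A "\<lambda>n. - g n"] assms by simp

lemma square_summable_shift:
  fixes f :: "int \<Rightarrow> complex"
  assumes "(\<lambda>n. (cmod (f n))\<^sup>2) summable_on UNIV"
  shows "(\<lambda>n. (cmod (f (n + k)))\<^sup>2) summable_on UNIV"
proof -
  have "bij_betw (\<lambda>n. n + k) UNIV UNIV"
    by (rule bij_betwI[of _ _ _ "\<lambda>n. n - k"]) auto
  from summable_on_reindex_bij_betw[OF this, of "\<lambda>n. (cmod (f n))\<^sup>2"] assms
  show ?thesis by simp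
qed

instantiation ell2 :: real_vector
begin

lift_definition zero_ell2 :: ell2 is "\<lambda>_. 0" by simp

lift_definition plus_ell2 :: "ell2 \<Rightarrow> ell2 \<Rightarrow> ell2" is "\<lambda>f g n. f n + g n"
  by (auto intro: square_summable_add)

lift_definition uminus_ell2 :: "ell2 \<Rightarrow> ell2" is "\<lambda>f n. - f n"
  by simp

lift_definition minus_ell2 :: "ell2 \<Rightarrow> ell2 \<Rightarrow> ell2" is "\<lambda>f g n. f n - g n"
  by (auto intro: square_summable_diff)

lift_definition scaleR_ell2 :: "real \<Rightarrow> ell2 \<Rightarrow> ell2" is "\<lambda>r f n. r *\<^sub>R f n"
  by (simp add: scaleR_conv_of_real square_summable_cmult)

instance
  by standard (transfer, simp add: algebra_simps fun_eq_iff)+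

end

lift_definition scaleC_ell2 :: "complex \<Rightarrow> ell2 \<Rightarrow> ell2" (infixr \<open>*\<^sub>C\<close> 75)
  is "\<lambda>c f n. c * f n"
  by (simp add: square_summable_cmult)

lemma ell2_eqI: "(\<And>n. ell2_nth f n = ell2_nth g n) \<Longrightarrow> f = g"
  by transfer auto

lemma ell2_nth_zero [simp]: "ell2_nth 0 n = 0"
  by transfer simp

lemma ell2_nth_add [simp]: "ell2_nth (f + g) n = ell2_nth f n + ell2_nth g n"
  by transfer simp

lemma ell2_nth_minus [simp]: "ell2_nth (- f) n = - ell2_nth f n"
  by transfer simp

lemma ell2_nth_diff [simp]: "ell2_nth (f - g) n = ell2_nth f n - ell2_nth g n"
  by transfer simp

lemma ell2_nth_scaleR [simp]: "ell2_nth (r *\<^sub>R f) n = r *\<^sub>R ell2_nth f n"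
  by transfer simp

lemma ell2_nth_scaleC [simp]: "ell2_nth (c *\<^sub>C f) n = c * ell2_nth f n"
  by transfer simp

lemma ell2_inner_summable: "(\<lambda>n. ell2_nth f n \<bullet> ell2_nth g n) summable_on UNIV"
proof -
  have "(\<lambda>n. norm (ell2_nth f n \<bullet> ell2_nth g n)) summable_on UNIV"
  proof (rule Infinite_Sum.abs_summable_on_comparison_test')
    show "(\<lambda>n. (cmod (ell2_nth f n))\<^sup>2 + (cmod (ell2_nth g n))\<^sup>2) summable_on UNIV"
      by (intro summable_on_add ell2_nth_summable)
    fix n :: int
    have "norm (ell2_nth f n \<bullet> ell2_nth g n) \<le> cmod (ell2_nth f n) * cmod (ell2_nth g n)"
      using Cauchy_Schwarz_ineq2 by simp
    also have "\<dots> \<le> (cmod (ell2_nth f n))\<^sup>2 + (cmod (ell2_nth g n))\<^sup>2"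
      using sum_squares_bound[of "cmod (ell2_nth f n)" "cmod (ell2_nth g n)"]
        mult_nonneg_nonneg[OF norm_ge_zero norm_ge_zero, of "ell2_nth f n" "ell2_nth g n"] by linarith
    finally show "norm (ell2_nth f n \<bullet> ell2_nth g n)
        \<le> (cmod (ell2_nth f n))\<^sup>2 + (cmod (ell2_nth g n))\<^sup>2" .
  qed
  then show ?thesis by (rule abs_summable_summable)
qed

text \<open>The underlying real Hilbert space structure: the real inner product is the real part of the
  complex one, so the induced norm is the usual norm of \<open>\<ell>\<^sup>2\<close>.\<close>

instantiation ell2 :: real_inner
begin

definition inner_ell2 :: "ell2 \<Rightarrow> ell2 \<Rightarrow> real"
  where "inner_ell2 f g = (\<Sum>\<^sub>\<infinity>n. ell2_nth f n \<bullet> ell2_nth g n)"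

definition norm_ell2 :: "ell2 \<Rightarrow> real"
  where "norm_ell2 f = sqrt (\<Sum>\<^sub>\<infinity>n. (cmod (ell2_nth f n))\<^sup>2)"

definition sgn_ell2 :: "ell2 \<Rightarrow> ell2"
  where "sgn_ell2 f = f /\<^sub>R norm f"

definition dist_ell2 :: "ell2 \<Rightarrow> ell2 \<Rightarrow> real"
  where "dist_ell2 f g = norm (f - g)"

definition uniformity_ell2 :: "(ell2 \<times> ell2) filter"
  where "uniformity_ell2 = (INF e\<in>{0<..}. principal {(x, y). dist x y < e})"

definition open_ell2 :: "ell2 set \<Rightarrow> bool"
  where "open_ell2 U = (\<forall>x\<in>U. eventually (\<lambda>(x', y). x' = x \<longrightarrow> y \<in> U) uniformity)"

instance
proof
  fix f g h :: ell2 and r :: real and U :: "ell2 set"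
  show "dist f g = norm (f - g)" by (rule dist_ell2_def)
  show "sgn f = f /\<^sub>R norm f" by (rule sgn_ell2_def)
  show "(uniformity :: (ell2 \<times> ell2) filter) = (INF e\<in>{0<..}. principal {(x, y). dist x y < e})"
    by (rule uniformity_ell2_def)
  show "open U = (\<forall>x\<in>U. eventually (\<lambda>(x', y). x' = x \<longrightarrow> y \<in> U) uniformity)"
    by (rule open_ell2_def)
  show "f \<bullet> g = g \<bullet> f"
    by (simp add: inner_ell2_def inner_commute)
  show "(f + g) \<bullet> h = f \<bullet> h + g \<bullet> h"
    by (simp add: inner_ell2_def inner_add_left infsum_add ell2_inner_summable)
  show "(r *\<^sub>R f) \<bullet> g = r * (f \<bullet> g)"
    by (simp add: inner_ell2_def infsum_cmult_right')
  show "0 \<le> f \<bullet> f"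
    by (simp add: inner_ell2_def infsum_nonneg)
  show "f \<bullet> f = 0 \<longleftrightarrow> f = 0"
  proof
    assume *: "f \<bullet> f = 0"
    show "f = 0"
    proof (rule ell2_eqI)
      fix n
      have "ell2_nth f n \<bullet> ell2_nth f n = 0"
        by (rule nonneg_infsum_le_0D[where A = UNIV])
          (use * ell2_inner_summable in \<open>auto simp: inner_ell2_def\<close>)
      then show "ell2_nth f n = ell2_nth 0 n" by simp
    qed
  qed (simp add: inner_ell2_def)
  show "norm f = sqrt (f \<bullet> f)"
    by (simp add: inner_ell2_def norm_ell2_def power2_norm_eq_inner)
qed

end

lemma norm_ell2_square: "(norm f)\<^sup>2 = (\<Sum>\<^sub>\<infinity>n. (cmod (ell2_nth f n))\<^sup>2)"
  by (simp add: norm_ell2_def infsum_nonneg)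

lemma sum_le_norm_ell2_square:
  assumes "finite F"
  shows "(\<Sum>n\<in>F. (cmod (ell2_nth f n))\<^sup>2) \<le> (norm f)\<^sup>2"
  unfolding norm_ell2_square
  by (rule finite_sum_le_infsum) (use assms ell2_nth_summable in auto)

lemma cmod_ell2_nth_le: "cmod (ell2_nth f n) \<le> norm f"
  by (rule power2_le_imp_le) (use sum_le_norm_ell2_square[of "{n}" f] in auto)

lemma norm_ell2_le:
  assumes "0 \<le> B" "\<And>F. finite F \<Longrightarrow> (\<Sum>n\<in>F. (cmod (ell2_nth f n))\<^sup>2) \<le> B\<^sup>2"
  shows "norm f \<le> B"
proof (rule power2_le_imp_le)
  show "(norm f)\<^sup>2 \<le> B\<^sup>2"
    unfolding norm_ell2_square by (rule infsum_le_finite_sums) (use assms ell2_nth_summable in auto)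
qed fact

instance ell2 :: banach
proof
  fix X :: "nat \<Rightarrow> ell2"
  assume "Cauchy X"
  then have X: "\<exists>M. \<forall>k\<ge>M. \<forall>l\<ge>M. norm (X k - X l) < e" if "e > 0" for e
    using that by (simp add: Cauchy_iff)
  have "Cauchy (\<lambda>k. ell2_nth (X k) n)" for n
    unfolding Cauchy_iff
  proof (intro allI impI)
    fix e :: real assume "e > 0"
    then obtain M where M: "\<forall>k\<ge>M. \<forall>l\<ge>M. norm (X k - X l) < e" using X by blast
    have "cmod (ell2_nth (X k) n - ell2_nth (X l) n) \<le> norm (X k - X l)" for k l
      using cmod_ell2_nth_le[of "X k - X l" n] by simp
    then show "\<exists>M. \<forall>k\<ge>M. \<forall>l\<ge>M. cmod (ell2_nth (X k) n - ell2_nth (X l) n) < e"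
      using M by (meson le_less_trans)
  qed
  then have "\<exists>L. (\<lambda>k. ell2_nth (X k) n) \<longlonglongrightarrow> L" for n
    using Cauchy_convergent_iff convergent_def by blast
  then obtain g where g: "\<And>n. (\<lambda>k. ell2_nth (X k) n) \<longlonglongrightarrow> g n" by metis
  have fin: "(\<Sum>n\<in>F. (cmod (ell2_nth (X k) n - g n))\<^sup>2) \<le> e\<^sup>2"
    if "finite F" "k \<ge> M" and M: "\<forall>k\<ge>M. \<forall>l\<ge>M. norm (X k - X l) < e" for e M k F
  proof (rule LIMSEQ_le_const2)
    show "(\<lambda>l. \<Sum>n\<in>F. (cmod (ell2_nth (X k) n - ell2_nth (X l) n))\<^sup>2)
        \<longlonglongrightarrow> (\<Sum>n\<in>F. (cmod (ell2_nth (X k) n - g n))\<^sup>2)"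
      by (intro tendsto_intros g)
    have "(\<Sum>n\<in>F. (cmod (ell2_nth (X k) n - ell2_nth (X l) n))\<^sup>2) \<le> e\<^sup>2" if "l \<ge> M" for l
    proof -
      have "(\<Sum>n\<in>F. (cmod (ell2_nth (X k) n - ell2_nth (X l) n))\<^sup>2) \<le> (norm (X k - X l))\<^sup>2"
        using sum_le_norm_ell2_square[OF \<open>finite F\<close>, of "X k - X l"] by simp
      also have "\<dots> \<le> e\<^sup>2"
        using M \<open>k \<ge> M\<close> that by (intro power_mono) (auto intro: less_imp_le)
      finally show ?thesis .
    qed
    then show "\<exists>N. \<forall>l\<ge>N. (\<Sum>n\<in>F. (cmod (ell2_nth (X k) n - ell2_nth (X l) n))\<^sup>2) \<le> e\<^sup>2"
      by blast
  qed
  have diff: "(\<lambda>n. (cmod (ell2_nth (X k) n - g n))\<^sup>2) summable_on UNIV"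
    if "k \<ge> M" and M: "\<forall>k\<ge>M. \<forall>l\<ge>M. norm (X k - X l) < e" for e M k
    using fin[OF _ that] by (intro nonneg_bdd_above_summable_on bdd_aboveI2[where M = "e\<^sup>2"]) auto
  obtain M where M: "\<forall>k\<ge>M. \<forall>l\<ge>M. norm (X k - X l) < 1" using X[of 1] by auto
  have "(\<lambda>n. (cmod (ell2_nth (X M) n + (- 1) * (ell2_nth (X M) n - g n)))\<^sup>2) summable_on UNIV"
    by (intro square_summable_add square_summable_cmult diff[OF _ M] ell2_nth_summable) simp
  then have "(\<lambda>n. (cmod (g n))\<^sup>2) summable_on UNIV" by simp
  then have nth: "ell2_nth (Abs_ell2 g) = g" by (simp add: Abs_ell2_inverse)
  have "X \<longlonglongrightarrow> Abs_ell2 g"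
  proof (rule LIMSEQ_I)
    fix e :: real assume e: "e > 0"
    then obtain M where M: "\<forall>k\<ge>M. \<forall>l\<ge>M. norm (X k - X l) < e / 2"
      using X[of "e / 2"] by auto
    have "norm (X k - Abs_ell2 g) \<le> e / 2" if "k \<ge> M" for k
      by (rule norm_ell2_le) (use e fin[OF _ that M] in \<open>auto simp: nth\<close>)
    then show "\<exists>M. \<forall>k\<ge>M. norm (X k - Abs_ell2 g) < e"
      using e by (intro exI[of _ M]) force
  qed
  then show "convergent X" by (auto simp: convergent_def)
qed

lemma norm_scaleC_ell2: "norm (c *\<^sub>C f) = cmod c * norm f"
  by (simp add: norm_ell2_def norm_mult power_mult_distrib infsum_cmult_right' real_sqrt_mult)

lemma square_summable_delta:
  "(\<lambda>k. (cmod (if k = n then 1 else 0))\<^sup>2) summable_on (UNIV :: int set)"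
proof -
  have "(\<lambda>k. (cmod (if k = n then 1 else 0))\<^sup>2) summable_on {n}"
    by (rule summable_on_finite) simp
  then show ?thesis
    by (subst summable_on_cong_neutral[where T = "{n}"]) auto
qed

lift_definition delta :: "int \<Rightarrow> ell2" is "\<lambda>n k. if k = n then 1 else 0"
  using square_summable_delta by simp

text \<open>The complex inner product, conjugate-linear in the first argument.\<close>

definition cinner :: "ell2 \<Rightarrow> ell2 \<Rightarrow> complex"
  where "cinner f g = (\<Sum>\<^sub>\<infinity>n. cnj (ell2_nth f n) * ell2_nth g n)"


section \<open>Bounded operators, spectrum and exponential\<close>

lemma bounded_linear_scaleC_ell2: "bounded_linear (\<lambda>f. c *\<^sub>C f)"
proof (rule bounded_linear_intro[of _ "cmod c"])
  show "c *\<^sub>C (f + g) = c *\<^sub>C f + c *\<^sub>C g" for f g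
    by (rule ell2_eqI) (simp add: algebra_simps)
  show "c *\<^sub>C (r *\<^sub>R f) = r *\<^sub>R (c *\<^sub>C f)" for r f
    by (rule ell2_eqI) simp
  show "norm (c *\<^sub>C f) \<le> norm f * cmod c" for f
    by (simp add: norm_scaleC_ell2)
qed

lift_definition scalar_op :: "complex \<Rightarrow> ell2 \<Rightarrow>\<^sub>L ell2" is "\<lambda>c f. c *\<^sub>C f"
  by (rule bounded_linear_scaleC_ell2)

text \<open>The bounded inverse below is only required to be real-linear; for a complex-linear \<open>A\<close> it is
  automatically complex-linear, so this is the usual spectrum.\<close>

definition op_spectrum :: "(ell2 \<Rightarrow>\<^sub>L ell2) \<Rightarrow> complex set"
  where "op_spectrum A = {z. \<not> (\<exists>B. (A - scalar_op z) o\<^sub>L B = id_blinfun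
                                  \<and> B o\<^sub>L (A - scalar_op z) = id_blinfun)}"

primrec op_power :: "(ell2 \<Rightarrow>\<^sub>L ell2) \<Rightarrow> nat \<Rightarrow> ell2 \<Rightarrow>\<^sub>L ell2" where
  "op_power A 0 = id_blinfun"
| "op_power A (Suc k) = A o\<^sub>L op_power A k"

definition op_exp :: "(ell2 \<Rightarrow>\<^sub>L ell2) \<Rightarrow> ell2 \<Rightarrow>\<^sub>L ell2"
  where "op_exp A = (\<Sum>k. op_power A k /\<^sub>R fact k)"

lemma summable_op_exp: "summable (\<lambda>k. op_power A k /\<^sub>R fact k)"
proof (rule summable_comparison_test')
  show "summable (\<lambda>k. norm A ^ k /\<^sub>R fact k)"
    by (rule summable_exp_generic)
  have "norm (op_power A k) \<le> norm A ^ k" for k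
  proof (induction k)
    case 0
    show ?case by (simp add: norm_blinfun_id_le)
  next
    case (Suc k)
    have "norm (A o\<^sub>L op_power A k) \<le> norm A * norm (op_power A k)"
      by (rule norm_blinfun_compose)
    also have "\<dots> \<le> norm A * norm A ^ k"
      using Suc by (intro mult_left_mono) auto
    finally show ?case by simp
  qed
  then show "norm (op_power A k /\<^sub>R fact k) \<le> norm A ^ k /\<^sub>R fact k" if "k \<ge> 0" for k
    by (simp add: divide_simps)
qed


section \<open>Discrete Schroedinger operators\<close>

definition schrodinger_fun :: "(int \<Rightarrow> real) \<Rightarrow> ell2 \<Rightarrow> ell2"
  where "schrodinger_fun V f =
    Abs_ell2 (\<lambda>n. ell2_nth f (n + 1) + ell2_nth f (n - 1) + of_real (V n) * ell2_nth f n)"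

text \<open>Meaningful for bounded \<open>V\<close> only; see \<open>schrodinger_nth\<close> below.\<close>

definition schrodinger :: "(int \<Rightarrow> real) \<Rightarrow> ell2 \<Rightarrow>\<^sub>L ell2"
  where "schrodinger V = Blinfun (schrodinger_fun V)"

lemma schrodinger_fun_nth:
  assumes "bounded (range V)"
  shows "ell2_nth (schrodinger_fun V f) n =
    ell2_nth f (n + 1) + ell2_nth f (n - 1) + of_real (V n) * ell2_nth f n"
proof -
  obtain B where B: "\<And>n. cmod (of_real (V n)) \<le> B"
    using assms by (auto simp: bounded_iff)
  have "(\<lambda>n. (cmod (ell2_nth f (n + 1) + ell2_nth f (n + (- 1))
      + of_real (V n) * ell2_nth f n))\<^sup>2) summable_on UNIV"
    by (intro square_summable_add square_summable_shift square_summable_mult_bounded[where B = B]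
        ell2_nth_summable B)
  then show ?thesis
    by (simp add: schrodinger_fun_def Abs_ell2_inverse)
qed

lemma norm_ell2_shift:
  assumes "\<And>n. ell2_nth g n = ell2_nth f (n + k)"
  shows "norm g = norm f"
proof -
  have "bij_betw (\<lambda>n. n + k) UNIV UNIV"
    by (rule bij_betwI[of _ _ _ "\<lambda>n. n - k"]) auto
  from infsum_reindex_bij_betw[OF this, of "\<lambda>n. (cmod (ell2_nth f n))\<^sup>2"] assms
  show ?thesis by (simp add: norm_ell2_def)
qed

lemma norm_ell2_mult_bounded:
  assumes "\<And>n. ell2_nth g n = v n * ell2_nth f n" "\<And>n. cmod (v n) \<le> B"
  shows "norm g \<le> B * norm f"
proof (rule norm_ell2_le)
  have B: "B \<ge> 0" using assms(2)[of 0] norm_ge_zero[of "v 0"] by linarith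
  then show "0 \<le> B * norm f" by simp
  fix F :: "int set" assume "finite F"
  have "(\<Sum>n\<in>F. (cmod (ell2_nth g n))\<^sup>2) \<le> (\<Sum>n\<in>F. B\<^sup>2 * (cmod (ell2_nth f n))\<^sup>2)"
    using assms
    by (auto simp: norm_mult power_mult_distrib intro!: sum_mono mult_right_mono power_mono)
  also have "\<dots> \<le> B\<^sup>2 * (norm f)\<^sup>2"
    using sum_le_norm_ell2_square[OF \<open>finite F\<close>, of f]
    by (auto simp: sum_distrib_left[symmetric] intro!: mult_left_mono)
  finally show "(\<Sum>n\<in>F. (cmod (ell2_nth g n))\<^sup>2) \<le> (B * norm f)\<^sup>2"
    by (simp add: power_mult_distrib)
qed

lemma bounded_linear_schrodinger_fun:
  assumes V: "bounded (range V)"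
  shows "bounded_linear (schrodinger_fun V)"
proof -
  note nth = schrodinger_fun_nth[OF V]
  obtain B where B: "\<And>n. cmod (of_real (V n)) \<le> B"
    using V by (auto simp: bounded_iff)
  show ?thesis
  proof (rule bounded_linear_intro[of _ "2 + B"])
    show "schrodinger_fun V (f + g) = schrodinger_fun V f + schrodinger_fun V g" for f g
      by (rule ell2_eqI) (simp add: nth algebra_simps)
    show "schrodinger_fun V (r *\<^sub>R f) = r *\<^sub>R schrodinger_fun V f" for r f
      by (rule ell2_eqI) (simp add: nth algebra_simps)
    fix f
    define R where "R = Abs_ell2 (\<lambda>n. ell2_nth f (n + 1))"
    define L where "L = Abs_ell2 (\<lambda>n. ell2_nth f (n + (- 1)))"
    define M where "M = Abs_ell2 (\<lambda>n. of_real (V n) * ell2_nth f n)"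
    have R: "ell2_nth R n = ell2_nth f (n + 1)" for n
      unfolding R_def by (subst Abs_ell2_inverse)
        (auto intro: square_summable_shift ell2_nth_summable)
    have L: "ell2_nth L n = ell2_nth f (n + (- 1))" for n
      unfolding L_def by (subst Abs_ell2_inverse)
        (use square_summable_shift[OF ell2_nth_summable, of f "- 1"] in auto)
    have M: "ell2_nth M n = of_real (V n) * ell2_nth f n" for n
      unfolding M_def by (subst Abs_ell2_inverse)
        (use square_summable_mult_bounded[OF ell2_nth_summable, of "\<lambda>n. of_real (V n)" B f] B
          in \<open>auto simp del: norm_mult\<close>)
    have "schrodinger_fun V f = R + L + M"
      by (rule ell2_eqI) (simp add: nth R L M)
    then have "norm (schrodinger_fun V f) \<le> norm R + norm L + norm M"
      by (metis norm_triangle_ineq norm_triangle_le add_right_mono)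
    also have "\<dots> \<le> norm f + norm f + B * norm f"
      using norm_ell2_shift[OF R] norm_ell2_shift[OF L] norm_ell2_mult_bounded[OF M B] by simp
    finally show "norm (schrodinger_fun V f) \<le> norm f * (2 + B)"
      by (simp add: algebra_simps)
  qed
qed

lemma schrodinger_nth:
  assumes "bounded (range V)"
  shows "ell2_nth (schrodinger V f) n =
    ell2_nth f (n + 1) + ell2_nth f (n - 1) + of_real (V n) * ell2_nth f n"
  by (simp add: schrodinger_def bounded_linear_Blinfun_apply bounded_linear_schrodinger_fun
      schrodinger_fun_nth assms)

definition evolution :: "(int \<Rightarrow> real) \<Rightarrow> real \<Rightarrow> ell2 \<Rightarrow>\<^sub>L ell2"
  where "evolution V t = op_exp (scalar_op (- \<i> * of_real t) o\<^sub>L schrodinger V)"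

definition avg_prob :: "(int \<Rightarrow> real) \<Rightarrow> int \<Rightarrow> real \<Rightarrow> real"
  where "avg_prob V n T = 2 / T *
    (LBINT t:{0..}. exp (- 2 * t / T) * (cmod (cinner (evolution V t (delta 1)) (delta n)))\<^sup>2)"

definition P_right :: "(int \<Rightarrow> real) \<Rightarrow> int \<Rightarrow> real \<Rightarrow> real"
  where "P_right V N T = (\<Sum>\<^sub>\<infinity>n\<in>{N<..}. avg_prob V n T)"

definition P_left :: "(int \<Rightarrow> real) \<Rightarrow> int \<Rightarrow> real \<Rightarrow> real"
  where "P_left V N T = (\<Sum>\<^sub>\<infinity>n\<in>{..<-N}. avg_prob V n T)"


section \<open>Transfer matrices\<close>

definition transfer_step :: "(int \<Rightarrow> real) \<Rightarrow> int \<Rightarrow> complex \<Rightarrow> complex^2^2"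
  where "transfer_step V m z = vector [vector [z - of_real (V m), -1], vector [1, 0]]"

primrec transfer_pos :: "(int \<Rightarrow> real) \<Rightarrow> nat \<Rightarrow> complex \<Rightarrow> complex^2^2" where
  "transfer_pos V 0 z = mat 1"
| "transfer_pos V (Suc k) z = transfer_step V (int (Suc k)) z ** transfer_pos V k z"

text \<open>\<open>transfer_neg V k z\<close> is \<open>T(-k+1,z)\<^sup>-\<^sup>1 \<cdots> T(0,z)\<^sup>-\<^sup>1\<close>, i.e. \<open>\<Phi>(-k,z)\<close>.\<close>

primrec transfer_neg :: "(int \<Rightarrow> real) \<Rightarrow> nat \<Rightarrow> complex \<Rightarrow> complex^2^2" where
  "transfer_neg V 0 z = mat 1"
| "transfer_neg V (Suc k) z = matrix_inv (transfer_step V (- int k) z) ** transfer_neg V k z"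

definition transfer :: "(int \<Rightarrow> real) \<Rightarrow> int \<Rightarrow> complex \<Rightarrow> complex^2^2"
  where "transfer V n z = (if n \<ge> 0 then transfer_pos V (nat n) z else transfer_neg V (nat (- n)) z)"

definition op_norm :: "complex^2^2 \<Rightarrow> real"
  where "op_norm A = onorm (\<lambda>x. A *v x)"

end

theory Submission
  imports Defs "HOL-Probability.Probability"
begin

text \<open>By Plancherel, \<open>a(n,T) = (\<pi>T)\<^sup>-\<^sup>1 \<integral> |G(n,1;E+i/T)|\<^sup>2 dE\<close>, where \<open>G\<close> is the Green function. Since the
  spectral radius of \<open>H\<close> is its norm, \<open>\<parallel>H\<parallel> \<le> K - 1\<close>, and for \<open>|E| \<ge> K\<close> the Neumann series makes
  \<open>G(n,1)\<close> decay like \<open>((K-1)/K)\<close> to the power \<open>|n-1|\<close>. For \<open>|E| \<le> K\<close> and \<open>1 \<le> n < m\<close>, constancy of the Wronskian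
  of \<open>G(\<cdot>,1)\<close> and \<open>G(\<cdot>,m)\<close> expresses \<open>G(1,m) \<Phi>(n) e\<close>, for a basis vector \<open>e\<close>, through products of two
  Green function values, one with an index \<open>m\<close>. Summing squares over \<open>m > N\<close> and using
  \<open>\<parallel>(H - z)\<^sup>-\<^sup>1\<parallel> \<le> T\<close> gives \<open>\<parallel>\<Phi>(n)\<parallel>\<^sup>2 \<Sum>\<^sub>m |G(1,m)|\<^sup>2 \<le> C T\<^sup>4\<close> for every \<open>n \<le> N\<close>, and the factor \<open>1/T\<close> in the
  Plancherel formula turns \<open>T\<^sup>4\<close> into \<open>T\<^sup>3\<close>.\<close>

section \<open>A Plancherel inequality\<close>

text \<open>The line of energies is cut at K because the spectrum keeps distance 1 from it: the
  Neumann ratio is then at most (K-1)/K uniformly in |E| >= K and in T, and c = 2 ln (K/(K-1)) is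
  its decay rate after squaring. Inside the window no such decay is available, and the transfer
  matrices must supply the bound. The obstacle is that they propagate homogeneous solutions, while
  G(.,1) has a source at 1 and gives a single vector where two columns must be controlled. A second
  Green function with source m beyond n supplies the other vector, and the same m is the site whose
  probability is estimated. Of the two factors in each product one is summed in square over m and
  the other bounded pointwise; each costs T^2. All estimates concern finite sets F of sites, with
  constants independent of F, and pass to the tail sums at the very end. The majorant in E that is
  finally integrated also provides the integrability of |G|^2 that the Plancherel inequality asks
  for. Since l2 is handled as a real inner product space, self-adjointness enters as symmetry of H
  and antisymmetry of iH.\<close>

lemma Fubini_bounded_kernel:
  fixes f :: "'a \<Rightarrow> complex" and g :: "'b \<Rightarrow> complex" and k :: "'a \<Rightarrow> 'b \<Rightarrow> complex"
  assumes "sigma_finite_measure M" "sigma_finite_measure N"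
    and f: "integrable M f" and g: "integrable N g"
    and k[measurable]: "case_prod k \<in> borel_measurable (M \<Otimes>\<^sub>M N)"
    and k1: "\<And>x y. norm (k x y) \<le> 1"
  shows "(\<integral>y. g y * (\<integral>x. f x * k x y \<partial>M) \<partial>N) = (\<integral>x. f x * (\<integral>y. g y * k x y \<partial>N) \<partial>M)"
proof -
  interpret M: sigma_finite_measure M by fact
  interpret N: sigma_finite_measure N by fact
  interpret pair_sigma_finite M N ..
  have [measurable]: "f \<in> borel_measurable M" "g \<in> borel_measurable N"
    using f g by auto
  \<comment> \<open>A kernel of modulus at most 1 preserves integrability of
    \<open>f x * g y\<close>; in both uses below the kernel is a phase.\<close>
  have "integrable (M \<Otimes>\<^sub>M N) (\<lambda>(x, y). f x * g y)"
  proof (rule Fubini_integrable)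
    show "integrable M (\<lambda>x. \<integral>y. norm (case (x, y) of (x, y) \<Rightarrow> f x * g y) \<partial>N)"
      using integrable_norm[OF f] by (simp add: norm_mult)
    show "AE x in M. integrable N (\<lambda>y. case (x, y) of (x, y) \<Rightarrow> f x * g y)"
      using g by simp
  qed measurable
  then have "integrable (M \<Otimes>\<^sub>M N) (\<lambda>(x, y). f x * g y * k x y)"
    by (rule Bochner_Integration.integrable_bound)
      (auto simp: norm_mult intro!: mult_right_le_one_le k1 AE_I2)
  from Fubini_integral[OF this] show ?thesis
    by (simp add: mult_ac flip: integral_mult_right_zero)
qed

text \<open>Damping \<open>|F|\<^sup>2\<close> by a Gaussian turns its integral into one of \<open>f\<close> against a narrow Gaussian
  average of \<open>f\<close>; letting the width tend to \<open>0\<close> gives one half of Plancherel's theorem.\<close>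

lemma fourier_square_gaussian:
  fixes f F :: "real \<Rightarrow> complex"
  assumes f: "integrable lborel f"
    and F: "\<And>E. F E = (\<integral>t. f t * iexp (E * t) \<partial>lborel)"
    and s: "s > 0"
  shows "(\<integral>x. F (x / s) * cnj (F (x / s)) \<partial>std_normal_distribution)
    = s * (\<integral>t. cnj (f t) * (\<integral>x. f (t + s * x) * complex_of_real (exp (- x\<^sup>2 / 2)) \<partial>lborel) \<partial>lborel)"
proof -
  let ?N = "std_normal_distribution"
  interpret N: real_distribution ?N by (rule real_dist_normal_dist)
  have [measurable]: "f \<in> borel_measurable borel" using f by auto
  have [measurable]: "cnj \<in> borel_measurable borel"
    by (intro borel_measurable_continuous_onI continuous_intros)
  have cf: "integrable lborel (\<lambda>t. cnj (f t))" using f by (simp add: integrable_cnj)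
  have [measurable]: "F \<in> borel_measurable borel"
    unfolding F[abs_def] by measurable
  have sf: "sigma_finite_measure ?N" by unfold_locales
  have sl: "sigma_finite_measure lborel" by unfold_locales
  have Fb: "norm (F E) \<le> (\<integral>t. norm (f t) \<partial>lborel)" for E
    unfolding F by (rule order_trans[OF integral_norm_bound]) (simp add: norm_mult)
  have Fint: "integrable ?N (\<lambda>x. F (x / s))"
    by (rule N.integrable_const_bound[where B = "\<integral>t. norm (f t) \<partial>lborel"]) (auto simp: Fb)
  have cF: "cnj (F E) = (\<integral>t. cnj (f t) * iexp (- E * t) \<partial>lborel)" for E
    unfolding F by (simp add: exp_cnj flip: Bochner_Integration.integral_cnj)
  have one: "integrable ?N (\<lambda>x. 1 :: complex)" by simp
  have "(\<integral>x. F (x / s) * cnj (F (x / s)) \<partial>?N)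
      = (\<integral>x. F (x / s) * (\<integral>t. cnj (f t) * iexp (- (x / s) * t) \<partial>lborel) \<partial>?N)"
    by (simp only: cF)
  also have "\<dots> = (\<integral>t. cnj (f t) * (\<integral>x. F (x / s) * iexp (- (x / s) * t) \<partial>?N) \<partial>lborel)"
    by (rule Fubini_bounded_kernel[OF sl sf cf Fint]) auto
  also have "\<dots> = (\<integral>t. cnj (f t) * (s * (\<integral>x. f (t + s * x) * complex_of_real (exp (- x\<^sup>2 / 2)) \<partial>lborel)) \<partial>lborel)"
  proof (intro Bochner_Integration.integral_cong refl arg_cong[where f = "(*) (cnj (f _))"])
    fix t
    have "(\<integral>x. F (x / s) * iexp (- (x / s) * t) \<partial>?N)
      = (\<integral>x. 1 * (\<integral>r. f r * iexp ((r - t) / s * x) \<partial>lborel) \<partial>?N)"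
      unfolding F
      by (subst integral_mult_left_zero[symmetric])
        (auto simp: algebra_simps diff_divide_distrib exp_diff exp_minus field_simps
          intro!: Bochner_Integration.integral_cong)
    also have "\<dots> = (\<integral>r. f r * (\<integral>x. 1 * iexp ((r - t) / s * x) \<partial>?N) \<partial>lborel)"
      by (rule Fubini_bounded_kernel[OF sl sf f one]) auto
    \<comment> \<open>The characteristic function of the standard normal law turns the average over
      frequencies into a Gaussian in (r - t)/s.\<close>
    also have "\<dots> = (\<integral>r. f r * complex_of_real (exp (- ((r - t) / s)\<^sup>2 / 2)) \<partial>lborel)"
      using fun_cong[OF char_std_normal_distribution]
      by (intro Bochner_Integration.integral_cong refl) (simp only: char_def mult_1)
    \<comment> \<open>Substitution r = t + s x, whose Jacobian is the factor s.\<close>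
    also have "\<dots> = s * (\<integral>x. f (t + s * x) * complex_of_real (exp (- x\<^sup>2 / 2)) \<partial>lborel)"
      using s by (subst lborel_integral_real_affine[where c = s and t = t])
        (auto simp: scaleR_conv_of_real)
    finally show "(\<integral>x. F (x / s) * iexp (- (x / s) * t) \<partial>?N)
        = s * (\<integral>x. f (t + s * x) * complex_of_real (exp (- x\<^sup>2 / 2)) \<partial>lborel)" .
  qed
  finally show ?thesis
    by (simp add: mult.left_commute)
qed

text \<open>Boundedness and continuity almost everywhere make the narrow Gaussian averages converge
  to f. Continuity is asked for only almost everywhere because the damped evolution, extended by
  zero, may jump at time 0.\<close>

lemma fourier_square_integral_ge:
  fixes f F :: "real \<Rightarrow> complex"
  assumes f: "integrable lborel f"
    and F: "\<And>E. F E = (\<integral>t. f t * iexp (E * t) \<partial>lborel)"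
    and B: "\<And>t. norm (f t) \<le> B"
    and cont: "AE t in lborel. isCont f t"
    and F2: "integrable lborel (\<lambda>E. (norm (F E))\<^sup>2)"
  shows "2 * pi * (\<integral>t. (norm (f t))\<^sup>2 \<partial>lborel) \<le> (\<integral>E. (norm (F E))\<^sup>2 \<partial>lborel)"
proof -
  let ?N = "std_normal_distribution"
  interpret N: real_distribution ?N by (rule real_dist_normal_dist)
  have [measurable]: "f \<in> borel_measurable borel" using f by auto
  have [measurable]: "cnj \<in> borel_measurable borel"
    by (intro borel_measurable_continuous_onI continuous_intros)
  have [measurable]: "F \<in> borel_measurable borel"
    unfolding F[abs_def] by measurable
  define J where "J = (\<lambda>s. \<integral>t. cnj (f t) * (\<integral>x. f (t + s * x) \<partial>?N) \<partial>lborel)"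
  define s where "s = (\<lambda>n::nat. 1 / real (Suc n))"
  have s0: "s n > 0" for n by (simp add: s_def)
  have slim: "s \<longlonglongrightarrow> 0" unfolding s_def by (rule LIMSEQ_Suc[OF lim_1_over_n])
  have J: "(\<integral>x. f (t + s n * x) * complex_of_real (exp (- x\<^sup>2 / 2)) \<partial>lborel)
      = sqrt (2 * pi) * (\<integral>x. f (t + s n * x) \<partial>?N)" for t n
    by (subst integral_density)
      (auto simp: normal_density_nonneg std_normal_density_def scaleR_conv_of_real mult_ac)
  have le: "norm (J (s n)) * (2 * pi) \<le> (\<integral>E. (norm (F E))\<^sup>2 \<partial>lborel)" for n
  proof -
    have "complex_of_real (s n * sqrt (2 * pi)) * J (s n) = (\<integral>x. F (x / s n) * cnj (F (x / s n)) \<partial>?N)"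
      unfolding fourier_square_gaussian[OF f F s0] J J_def mult.left_commute[of "cnj _"] integral_mult_right_zero
      by (simp add: mult_ac)
    also have "\<dots> = (\<integral>x. complex_of_real ((norm (F (x / s n)))\<^sup>2) \<partial>?N)"
      by (simp only: complex_norm_square)
    also have "\<dots> = complex_of_real (\<integral>x. (norm (F (x / s n)))\<^sup>2 \<partial>?N)"
      by (rule integral_complex_of_real)
    finally have "s n * sqrt (2 * pi) * norm (J (s n)) = \<bar>\<integral>x. (norm (F (x / s n)))\<^sup>2 \<partial>?N\<bar>"
      using s0[of n] by (metis (no_types, lifting) abs_of_nonneg less_imp_le mult_nonneg_nonneg norm_mult norm_of_real pi_ge_zero real_sqrt_ge_0_iff zero_le_numeral)
    also have "\<dots> = (\<integral>x. (norm (F (x / s n)))\<^sup>2 \<partial>?N)"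
      by (intro abs_of_nonneg integral_nonneg_AE AE_I2) simp
    also have "\<dots> = (\<integral>x. std_normal_density x * (norm (F (x / s n)))\<^sup>2 \<partial>lborel)"
      by (subst integral_density) (auto simp: normal_density_nonneg)
    also have "\<dots> = s n * (\<integral>x. std_normal_density (s n * x) * (norm (F x))\<^sup>2 \<partial>lborel)"
      using s0[of n] by (subst lborel_integral_real_affine[where c = "s n" and t = 0]) auto
    \<comment> \<open>The Gaussian weight is at most 1/sqrt(2 pi); with the sqrt(2 pi) on the left
      this makes the constant 2 pi.\<close>
    also have "\<dots> \<le> s n * (\<integral>x. (norm (F x))\<^sup>2 / sqrt (2 * pi) \<partial>lborel)"
    proof (intro mult_left_mono integral_mono')
      show "std_normal_density (s n * x) * (norm (F x))\<^sup>2 \<le> (norm (F x))\<^sup>2 / sqrt (2 * pi)" for x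
        using mult_right_mono[of "exp (- (s n * x)\<^sup>2 / 2)" 1 "(norm (F x))\<^sup>2"]
        by (auto simp: std_normal_density_def divide_right_mono)
    qed (use F2 s0[of n] in auto)
    finally have "sqrt (2 * pi) * norm (J (s n)) \<le> (\<integral>x. (norm (F x))\<^sup>2 \<partial>lborel) / sqrt (2 * pi)"
      using s0[of n] by (simp add: mult.assoc mult_le_cancel_left_pos flip: times_divide_eq_right)
    then have "norm (J (s n)) * (sqrt (2 * pi) * sqrt (2 * pi)) \<le> (\<integral>x. (norm (F x))\<^sup>2 \<partial>lborel)"
      by (simp add: pos_le_divide_eq mult_ac)
    then show ?thesis by simp
  qed
  have inner: "(\<lambda>n. \<integral>x. f (t + s n * x) \<partial>?N) \<longlonglongrightarrow> f t" if "isCont f t" for t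
  proof -
    have "(\<lambda>n. \<integral>x. f (t + s n * x) \<partial>?N) \<longlonglongrightarrow> (\<integral>x. f t \<partial>?N)"
    proof (rule integral_dominated_convergence[where w = "\<lambda>_. B"])
      show "AE x in ?N. (\<lambda>n. f (t + s n * x)) \<longlonglongrightarrow> f t"
        by (intro AE_I2 isCont_tendsto_compose[OF that])
          (auto intro!: tendsto_eq_intros slim)
    qed (auto simp: B)
    then show ?thesis using N.prob_space by simp
  qed
  have "(\<lambda>n. J (s n)) \<longlonglongrightarrow> (\<integral>t. cnj (f t) * f t \<partial>lborel)"
    unfolding J_def
  proof (rule integral_dominated_convergence[where w = "\<lambda>t. B * norm (f t)"])
    show "AE t in lborel. (\<lambda>n. cnj (f t) * (\<integral>x. f (t + s n * x) \<partial>?N)) \<longlonglongrightarrow> cnj (f t) * f t"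
      using cont by eventually_elim (intro tendsto_intros inner)
    have "norm (\<integral>x. f (t + s n * x) \<partial>?N) \<le> B" for t n
      using B by (intro order_trans[OF integral_norm_bound] N.integral_le_const N.integrable_const_bound[where B = B]) auto
    then show "AE t in lborel. norm (cnj (f t) * (\<integral>x. f (t + s n * x) \<partial>?N)) \<le> B * norm (f t)" for n
      by (simp add: norm_mult mult.commute[of B] mult_left_mono)
    show "integrable lborel (\<lambda>t. B * norm (f t))" using f by simp
  qed auto
  also have "(\<integral>t. cnj (f t) * f t \<partial>lborel) = complex_of_real (\<integral>t. (norm (f t))\<^sup>2 \<partial>lborel)"
    unfolding integral_complex_of_real[symmetric]
    by (intro Bochner_Integration.integral_cong refl) (simp only: complex_norm_square mult.commute)
  finally have "(\<lambda>n. norm (J (s n))) \<longlonglongrightarrow> (\<integral>t. (norm (f t))\<^sup>2 \<partial>lborel)"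
    using tendsto_norm by fastforce
  then have lim: "(\<lambda>n. norm (J (s n)) * (2 * pi)) \<longlonglongrightarrow> (\<integral>t. (norm (f t))\<^sup>2 \<partial>lborel) * (2 * pi)"
    by (rule tendsto_mult_right)
  have "(\<integral>t. (norm (f t))\<^sup>2 \<partial>lborel) * (2 * pi) \<le> (\<integral>E. (norm (F E))\<^sup>2 \<partial>lborel)"
    by (rule LIMSEQ_le_const2[OF lim]) (use le in blast)
  then show ?thesis by (simp add: mult_ac)
qed

section \<open>Operators on square-summable sequences\<close>

text \<open>Differentiating termwise shifts the coefficients by one. The geometric bound lets the
  Weierstrass M-test give uniform convergence of the differentiated series on a bounded
  interval.\<close>

lemma exp_series_has_vector_derivative:
  fixes a :: "nat \<Rightarrow> 'b::banach"
  assumes a: "\<And>k. norm (a k) \<le> C * M ^ k"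
  shows "((\<lambda>t. \<Sum>k. (t ^ k / fact k) *\<^sub>R a k) has_vector_derivative
          (\<Sum>k. (t ^ k / fact k) *\<^sub>R a (Suc k))) (at t)"
proof -
  have C: "0 \<le> C" using order_trans[OF norm_ge_zero a[of 0]] by simp
  have M: "0 \<le> C * M" using order_trans[OF norm_ge_zero a[of 1]] by simp
  \<comment> \<open>This radius makes \<open>S\<close> contain both t and 0, the point where
    convergence of the series itself is anchored.\<close>
  define r where "r = \<bar>t\<bar> + 1"
  define S where "S = {-r<..<r}"
  have t: "t \<in> S" by (auto simp: S_def r_def)
  have r0: "r \<ge> 0" by (auto simp: r_def)
  have powr: "\<bar>x\<bar> ^ k \<le> r ^ k" if "x \<in> S" for x k
    using that by (intro power_mono) (auto simp: S_def)
  define f' where "f' = (\<lambda>k x h. h *\<^sub>R ((real k * x ^ (k - 1) / fact k) *\<^sub>R a k))"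
  define e where "e = (\<lambda>k x. (x ^ k / fact k) *\<^sub>R a (Suc k))"
  define g where "g = (\<lambda>x. \<Sum>k. e k x)"
  have sm: "summable (\<lambda>k. D * (s ^ k / fact k))" for D s :: real
    by (intro summable_mult) (use summable_exp_generic[of s] in \<open>simp add: divide_inverse mult.commute\<close>)
  have bnd: "norm (e k x) \<le> C * M * ((r * M) ^ k / fact k)" if "x \<in> S" for k x
  proof -
    have "norm (e k x) = \<bar>x\<bar> ^ k / fact k * norm (a (Suc k))"
      by (simp add: e_def power_abs)
    also have "\<dots> \<le> r ^ k / fact k * (C * M ^ Suc k)"
      by (intro mult_mono divide_right_mono powr[OF that] a) (use r0 in auto)
    finally show ?thesis by (simp add: power_mult_distrib mult_ac)
  qed
  have lim: "uniform_limit S (\<lambda>n x. \<Sum>k<n. e k x) g sequentially"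
    unfolding g_def by (rule Weierstrass_m_test[OF _ sm]) (rule bnd)
  \<comment> \<open>The derivative of the constant term is zero, hence the offset by one in the
    range of summation.\<close>
  have sumf': "(\<Sum>i<Suc n. f' i x h) = h *\<^sub>R (\<Sum>k<n. e k x)" for n x h
  proof -
    have "real (Suc k) * x ^ k / fact (Suc k) = x ^ k / fact k" for k
      by (simp add: divide_simps del: of_nat_Suc)
    then have "f' (Suc k) x h = h *\<^sub>R e k x" for k
      by (simp only: f'_def e_def diff_Suc_1)
    then show ?thesis
      unfolding sum.lessThan_Suc_shift by (simp add: f'_def scaleR_sum_right)
  qed
  have "\<exists>G. \<forall>x\<in>S. (\<lambda>n. (x ^ n / fact n) *\<^sub>R a n) sums G x
      \<and> (G has_derivative (\<lambda>h. h *\<^sub>R g x)) (at x within S)"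
  proof (rule has_derivative_series[where f' = f'])
    show "convex S" by (simp add: S_def)
    show "((\<lambda>x. (x ^ n / fact n) *\<^sub>R a n) has_derivative f' n x) (at x within S)" for n x
    proof -
      have "((\<lambda>x. x ^ n / fact n) has_real_derivative real n * x ^ (n - 1) / fact n) (at x within S)"
        by (auto intro!: derivative_eq_intros)
      from has_derivative_scaleR_left[OF this[unfolded has_field_derivative_def], of "a n"]
      show ?thesis by (simp add: f'_def mult.commute)
    qed
    show "\<forall>\<^sub>F n in sequentially. \<forall>x\<in>S. \<forall>h. norm (sum (\<lambda>i. f' i x h) {..<n} - h *\<^sub>R g x) \<le> \<epsilon> * norm h"
      if "\<epsilon> > 0" for \<epsilon>
    proof -
      obtain n0 where n0: "\<And>n x. n \<ge> n0 \<Longrightarrow> x \<in> S \<Longrightarrow> dist (\<Sum>k<n. e k x) (g x) < \<epsilon>"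
        using lim \<open>\<epsilon> > 0\<close> unfolding uniform_limit_iff eventually_sequentially by blast
      show ?thesis
        unfolding eventually_sequentially
      proof (intro exI[of _ "Suc n0"] allI impI ballI)
        fix n x h assume n: "Suc n0 \<le> n" and x: "x \<in> S"
        then obtain m where m: "n = Suc m" "m \<ge> n0" by (cases n) auto
        have "norm (sum (\<lambda>i. f' i x h) {..<n} - h *\<^sub>R g x) = \<bar>h\<bar> * norm ((\<Sum>k<m. e k x) - g x)"
          unfolding m sumf' scaleR_diff_right[symmetric] by simp
        also have "\<dots> \<le> \<bar>h\<bar> * \<epsilon>"
          using n0[OF m(2) x] by (intro mult_left_mono) (auto simp: dist_norm)
        finally show "norm (sum (\<lambda>i. f' i x h) {..<n} - h *\<^sub>R g x) \<le> \<epsilon> * norm h"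
          by (simp add: mult.commute)
      qed
    qed
    show "0 \<in> S" by (auto simp: S_def r_def)
    show "(\<lambda>n. (0 ^ n / fact n) *\<^sub>R a n) sums a 0"
      by (rule sums_cong[THEN iffD1, OF _ sums_If_finite_set[of "{0}" a, simplified]]) auto
  qed
  then obtain G where G: "\<And>x. x \<in> S \<Longrightarrow> (\<lambda>n. (x ^ n / fact n) *\<^sub>R a n) sums G x"
      "\<And>x. x \<in> S \<Longrightarrow> (G has_derivative (\<lambda>h. h *\<^sub>R g x)) (at x within S)" by blast
  have "open S" by (simp add: S_def)
  then have "(G has_derivative (\<lambda>h. h *\<^sub>R g t)) (at t)"
    using G(2)[OF t] t at_within_open by metis
  then have "((\<lambda>t. \<Sum>k. (t ^ k / fact k) *\<^sub>R a k) has_derivative (\<lambda>h. h *\<^sub>R g t)) (at t)"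
    using \<open>open S\<close> t by (rule has_derivative_transform_within_open) (use G(1) in \<open>simp add: sums_iff\<close>)
  then show ?thesis
    by (simp add: has_vector_derivative_def g_def e_def)
qed

lemma norm_op_power_le: "norm (op_power A k) \<le> norm A ^ k"
proof (induction k)
  case 0
  show ?case by (simp add: norm_blinfun_id_le)
next
  case (Suc k)
  have "norm (A o\<^sub>L op_power A k) \<le> norm A * norm (op_power A k)"
    by (rule norm_blinfun_compose)
  also have "\<dots> \<le> norm A * norm A ^ k"
    using Suc by (intro mult_left_mono) auto
  finally show ?case by simp
qed

lemma op_power_scaleR: "op_power (t *\<^sub>R A) k = t ^ k *\<^sub>R op_power A k"
  by (induction k)
    (simp_all add: bounded_bilinear.scaleR_left[OF bounded_bilinear_blinfun_compose]
      bounded_bilinear.scaleR_right[OF bounded_bilinear_blinfun_compose] mult.commute)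

lemma op_exp_scaleR_apply: "op_exp (t *\<^sub>R A) x = (\<Sum>k. (t ^ k / fact k) *\<^sub>R op_power A k x)"
proof -
  have "op_exp (t *\<^sub>R A) x = (\<Sum>k. (op_power (t *\<^sub>R A) k /\<^sub>R fact k) x)"
    unfolding op_exp_def
    by (rule bounded_linear.suminf[OF blinfun.bounded_linear_left summable_op_exp])
  then show ?thesis
    by (simp add: op_power_scaleR blinfun.scaleR_left field_simps)
qed

lemma op_exp_scaleR_has_vector_derivative:
  "((\<lambda>t. op_exp (t *\<^sub>R A) x) has_vector_derivative A (op_exp (t *\<^sub>R A) x)) (at t)"
proof -
  have bnd: "norm (op_power A k x) \<le> norm x * norm A ^ k" for k
    using norm_blinfun[of "op_power A k" x] mult_right_mono[OF norm_op_power_le[of A k] norm_ge_zero[of x]]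
    by (simp add: mult.commute)
  have sm: "summable (\<lambda>k. (t ^ k / fact k) *\<^sub>R op_power A k x)"
    using bounded_linear.summable[OF blinfun.bounded_linear_left summable_op_exp, of "t *\<^sub>R A" x]
    by (simp add: op_power_scaleR blinfun.scaleR_left field_simps)
  have "A (op_exp (t *\<^sub>R A) x) = (\<Sum>k. (t ^ k / fact k) *\<^sub>R op_power A (Suc k) x)"
    unfolding op_exp_scaleR_apply
    by (subst bounded_linear.suminf[OF blinfun.bounded_linear_right sm])
      (simp add: blinfun.scaleR_right)
  then show ?thesis
    using exp_series_has_vector_derivative[of "\<lambda>k. op_power A k x", OF bnd, of t]
    by (simp add: op_exp_scaleR_apply)
qed

lemma op_exp_zero: "op_exp 0 x = x"
proof -
  have "(\<lambda>k. ((0::real) ^ k / fact k) *\<^sub>R op_power 0 k x) = (\<lambda>k. if k = 0 then x else 0)"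
    by (auto simp: fun_eq_iff)
  then show ?thesis
    using op_exp_scaleR_apply[of 0 0 x] by (simp add: sums_unique[OF sums_single[of 0 "\<lambda>_. x"], symmetric])
qed

text \<open>The derivative of the squared norm is twice the inner product of A psi with psi, which
  is zero. For A = -iH this is unitarity of the evolution.\<close>

lemma norm_op_exp_antisymmetric:
  fixes A :: "ell2 \<Rightarrow>\<^sub>L ell2"
  assumes "\<And>x. A x \<bullet> x = 0"
  shows "norm (op_exp (t *\<^sub>R A) x) = norm x"
proof -
  define \<psi> where "\<psi> = (\<lambda>t. op_exp (t *\<^sub>R A) x)"
  have d: "(\<psi> has_vector_derivative A (\<psi> t)) (at t)" for t
    unfolding \<psi>_def by (rule op_exp_scaleR_has_vector_derivative)
  have "((\<lambda>t. \<psi> t \<bullet> \<psi> t) has_vector_derivative (\<psi> t \<bullet> A (\<psi> t) + A (\<psi> t) \<bullet> \<psi> t)) (at t)" for t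
    by (rule bounded_bilinear.has_vector_derivative[OF bounded_bilinear_inner d d])
  moreover have "\<psi> t \<bullet> A (\<psi> t) + A (\<psi> t) \<bullet> \<psi> t = 0" for t
    using assms[of "\<psi> t"] by (simp add: inner_commute)
  ultimately have "DERIV (\<lambda>t. \<psi> t \<bullet> \<psi> t) t :> 0" for t
    by (simp only: has_real_derivative_iff_has_vector_derivative)
  then have "\<psi> t \<bullet> \<psi> t = \<psi> 0 \<bullet> \<psi> 0"
    by (intro DERIV_isconst_all) auto
  then show ?thesis
    unfolding \<psi>_def by (simp add: norm_eq_sqrt_inner op_exp_zero)
qed

text \<open>If \<open>A \<plusminus> \<parallel>A\<parallel>\<close> are both invertible, then \<open>A\<^sup>2 - \<parallel>A\<parallel>\<^sup>2\<close> is bounded below, although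
  \<open>\<parallel>A\<^sup>2x - \<parallel>A\<parallel>\<^sup>2x\<parallel>\<^sup>2 \<le> \<parallel>A\<parallel>\<^sup>2 (\<parallel>A\<parallel>\<^sup>2\<parallel>x\<parallel>\<^sup>2 - \<parallel>Ax\<parallel>\<^sup>2)\<close> is relatively small for suitable \<open>x\<close>.\<close>

lemma eq_0_if_norm_notin_spectrum:
  fixes A :: "ell2 \<Rightarrow>\<^sub>L ell2"
  assumes "op_spectrum A \<inter> {complex_of_real (norm A), - complex_of_real (norm A)} = {}"
    and sym: "\<And>x y. A x \<bullet> y = x \<bullet> A y"
  shows "A = 0"
proof (rule ccontr)
  assume "A \<noteq> 0"
  define a where "a = norm A"
  have a: "a > 0" using \<open>A \<noteq> 0\<close> by (simp add: a_def)
  obtain B1 where B1: "B1 o\<^sub>L (A - scalar_op (complex_of_real a)) = id_blinfun"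
    using assms(1) by (auto simp: op_spectrum_def a_def)
  obtain B2 where B2: "B2 o\<^sub>L (A - scalar_op (- complex_of_real a)) = id_blinfun"
    using assms(1) by (auto simp: op_spectrum_def a_def)
  have s: "scalar_op (complex_of_real r) x = r *\<^sub>R x" for r x
    by (rule ell2_eqI) (simp add: scalar_op.rep_eq scaleR_conv_of_real)
  have 1: "B1 (A x - a *\<^sub>R x) = x" for x
    using arg_cong[OF B1, of "\<lambda>B. blinfun_apply B x"] by (simp add: blinfun.diff_left s)
  have 2: "B2 (A x + a *\<^sub>R x) = x" for x
    using arg_cong[OF B2, of "\<lambda>B. blinfun_apply B x"] s[of "- a" x]
    by (simp add: blinfun.diff_left)
  define c where "c = norm B2 * norm B1 + 1"
  have c: "c > 0" by (auto simp: c_def add_nonneg_pos)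
  have low: "norm x \<le> c * norm (A (A x) - (a\<^sup>2) *\<^sub>R x)" for x
  proof -
    have "A (A x) - (a\<^sup>2) *\<^sub>R x = A (A x + a *\<^sub>R x) - a *\<^sub>R (A x + a *\<^sub>R x)"
      by (simp add: blinfun.add_right blinfun.scaleR_right algebra_simps power2_eq_square)
    then have "x = B2 (B1 (A (A x) - (a\<^sup>2) *\<^sub>R x))"
      by (simp only: 1 2)
    then have "norm x \<le> norm B2 * norm (B1 (A (A x) - (a\<^sup>2) *\<^sub>R x))"
      using norm_blinfun by metis
    also have "\<dots> \<le> norm B2 * (norm B1 * norm (A (A x) - (a\<^sup>2) *\<^sub>R x))"
      by (intro mult_left_mono norm_blinfun) auto
    also have "\<dots> \<le> c * norm (A (A x) - (a\<^sup>2) *\<^sub>R x)"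
      by (simp add: c_def algebra_simps)
    finally show ?thesis .
  qed
  have key: "(norm (A x))\<^sup>2 \<le> (a\<^sup>2 - 1 / (c\<^sup>2 * a\<^sup>2)) * (norm x)\<^sup>2" for x
  proof -
    have n: "norm (A y) \<le> a * norm y" for y
      unfolding a_def by (rule norm_blinfun)
    have "(norm x)\<^sup>2 \<le> c\<^sup>2 * (norm (A (A x) - (a\<^sup>2) *\<^sub>R x))\<^sup>2"
      using power_mono[OF low[of x] norm_ge_zero, of 2] by (simp add: power_mult_distrib)
    \<comment> \<open>Symmetry turns the mixed term, the inner product of A(Ax) with x, into the
      squared norm of Ax.\<close>
    also have "(norm (A (A x) - (a\<^sup>2) *\<^sub>R x))\<^sup>2
        = (norm (A (A x)))\<^sup>2 - 2 * a\<^sup>2 * (norm (A x))\<^sup>2 + a\<^sup>2 * a\<^sup>2 * (norm x)\<^sup>2"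
      using sym[of "A x" x]
      by (simp add: power2_norm_eq_inner inner_diff_left inner_diff_right inner_commute algebra_simps)
    also have "c\<^sup>2 * \<dots> \<le> c\<^sup>2 * (a\<^sup>2 * (norm (A x))\<^sup>2 - 2 * a\<^sup>2 * (norm (A x))\<^sup>2 + a\<^sup>2 * a\<^sup>2 * (norm x)\<^sup>2)"
      using power_mono[OF n[of "A x"] norm_ge_zero, of 2]
      by (intro mult_left_mono) (auto simp: power_mult_distrib)
    finally have "(norm x)\<^sup>2 \<le> c\<^sup>2 * a\<^sup>2 * (a\<^sup>2 * (norm x)\<^sup>2 - (norm (A x))\<^sup>2)"
      by (simp add: algebra_simps)
    then have "(norm x)\<^sup>2 / (c\<^sup>2 * a\<^sup>2) \<le> a\<^sup>2 * (norm x)\<^sup>2 - (norm (A x))\<^sup>2"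
      using a c by (subst pos_divide_le_eq) (auto simp: mult_ac)
    then show ?thesis by (simp add: algebra_simps)
  qed
  have "norm A \<le> sqrt (a\<^sup>2 - 1 / (c\<^sup>2 * a\<^sup>2))"
  proof (rule norm_blinfun_bound)
    \<comment> \<open>A nonzero value of A forces the constant in \<open>key\<close> to be positive,
      so its square root is a genuine operator bound.\<close>
    obtain x where "A x \<noteq> 0" using \<open>A \<noteq> 0\<close> by (metis blinfun_eqI zero_blinfun.rep_eq)
    then have "0 < (a\<^sup>2 - 1 / (c\<^sup>2 * a\<^sup>2)) * (norm x)\<^sup>2"
      using key[of x] by (smt (verit) zero_less_norm_iff zero_less_power)
    then have nonneg: "0 \<le> a\<^sup>2 - 1 / (c\<^sup>2 * a\<^sup>2)"
      by (simp add: zero_less_mult_iff)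
    then show "0 \<le> sqrt (a\<^sup>2 - 1 / (c\<^sup>2 * a\<^sup>2))" by simp
    show "norm (A x) \<le> sqrt (a\<^sup>2 - 1 / (c\<^sup>2 * a\<^sup>2)) * norm x" for x
      by (rule power2_le_imp_le) (use key[of x] nonneg in \<open>auto simp: power_mult_distrib\<close>)
  qed
  moreover have "sqrt (a\<^sup>2 - 1 / (c\<^sup>2 * a\<^sup>2)) < a"
    using a c by (intro real_less_lsqrt) auto
  ultimately show False by (simp add: a_def)
qed

section \<open>The resolvent and the Green function\<close>

lemma ell2_shift_exists: "\<exists>g. \<forall>n. ell2_nth g n = ell2_nth f (n + k)"
  by (rule exI[of _ "Abs_ell2 (\<lambda>n. ell2_nth f (n + k))"])
    (simp add: Abs_ell2_inverse square_summable_shift ell2_nth_summable)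

lemma infsum_diff_real:
  fixes f g :: "'a \<Rightarrow> real"
  assumes "f summable_on A" "g summable_on A"
  shows "(\<Sum>\<^sub>\<infinity>x\<in>A. f x - g x) = infsum f A - infsum g A"
  using infsum_add[of f A "\<lambda>x. - g x"] assms by (simp add: infsum_uminus summable_on_uminus)

text \<open>The shifts by 1 and -1 are adjoint to each other, and a real potential acts
  symmetrically at each site.\<close>

lemma schrodinger_symmetric:
  assumes V: "bounded (range V)"
  shows "schrodinger V f \<bullet> g = f \<bullet> schrodinger V g"
proof -
  have shift: "(\<lambda>n. ell2_nth f (n + k) \<bullet> ell2_nth g n) summable_on UNIV" for f g k
  proof -
    obtain f' where "\<And>n. ell2_nth f' n = ell2_nth f (n + k)"
      using ell2_shift_exists[of f k] by blast
    then show ?thesis using ell2_inner_summable[of f' g] by simp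
  qed
  have reindex: "(\<Sum>\<^sub>\<infinity>n. ell2_nth f (n + k) \<bullet> ell2_nth g n) = (\<Sum>\<^sub>\<infinity>n. ell2_nth g (n - k) \<bullet> ell2_nth f n)"
    for f g k
  proof -
    have "bij_betw (\<lambda>n. n + k) UNIV UNIV"
      by (rule bij_betwI[of _ _ _ "\<lambda>n. n - k"]) auto
    from infsum_reindex_bij_betw[OF this, of "\<lambda>n. ell2_nth g (n - k) \<bullet> ell2_nth f n"]
    show ?thesis by (simp add: inner_commute)
  qed
  define S where "S = (\<lambda>f g n. ell2_nth f (n + 1) \<bullet> ell2_nth g n + ell2_nth f (n - 1) \<bullet> ell2_nth g n)"
  have S_sum: "S f g summable_on UNIV" for f g
    using summable_on_add[OF shift[of f 1 g] shift[of f "-1" g]] by (simp add: S_def)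
  have S_inf: "infsum (S f g) UNIV
      = (\<Sum>\<^sub>\<infinity>n. ell2_nth f (n + 1) \<bullet> ell2_nth g n) + (\<Sum>\<^sub>\<infinity>n. ell2_nth f (n - 1) \<bullet> ell2_nth g n)" for f g
    using infsum_add[OF shift[of f 1 g] shift[of f "-1" g]] by (simp add: S_def)
  have "infsum (S f g) UNIV = infsum (S g f) UNIV"
    using reindex[of f 1 g] reindex[of f "-1" g] by (simp add: S_inf)
  then have "(\<Sum>\<^sub>\<infinity>n. S f g n - S g f n) = 0"
    by (simp add: infsum_diff_real S_sum)
  moreover have "schrodinger V f \<bullet> g - f \<bullet> schrodinger V g = (\<Sum>\<^sub>\<infinity>n. S f g n - S g f n)"
    unfolding inner_ell2_def infsum_diff_real[OF ell2_inner_summable ell2_inner_summable, symmetric]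
  proof (rule infsum_cong)
    fix n
    have "(of_real (V n) * ell2_nth f n) \<bullet> ell2_nth g n = ell2_nth f n \<bullet> (of_real (V n) * ell2_nth g n)"
      by (simp flip: scaleR_conv_of_real)
    moreover have "ell2_nth f n \<bullet> ell2_nth g m = ell2_nth g m \<bullet> ell2_nth f n" for m
      by (rule inner_commute)
    ultimately show "ell2_nth (schrodinger V f) n \<bullet> ell2_nth g n - ell2_nth f n \<bullet> ell2_nth (schrodinger V g) n
        = S f g n - S g f n"
      by (simp add: S_def schrodinger_nth[OF V] inner_add_left inner_add_right)
  qed
  ultimately show ?thesis by simp
qed

lemma scaleC_minus_left: "(- c) *\<^sub>C f = - (c *\<^sub>C f)"
  by (rule ell2_eqI) simp

text \<open>For the real inner product, multiplication by i is antisymmetric; this does the work of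
  the conjugation in the complex one.\<close>

lemma inner_imaginary_unit: "f \<bullet> (\<i> *\<^sub>C g) = - ((\<i> *\<^sub>C f) \<bullet> g)"
proof -
  have "f \<bullet> (\<i> *\<^sub>C g) = (\<Sum>\<^sub>\<infinity>n. - (ell2_nth (\<i> *\<^sub>C f) n \<bullet> ell2_nth g n))"
    unfolding inner_ell2_def by (rule infsum_cong) (simp add: inner_complex_def)
  then show ?thesis
    by (simp only: infsum_uminus inner_ell2_def)
qed

lemma schrodinger_scaleC:
  assumes "bounded (range V)"
  shows "schrodinger V (c *\<^sub>C f) = c *\<^sub>C schrodinger V f"
  by (rule ell2_eqI) (simp add: schrodinger_nth[OF assms] algebra_simps)

text \<open>H is symmetric and commutes with the antisymmetric i, so iH is antisymmetric. This gives
  both norm conservation and the resolvent bound by 1 / Im z.\<close>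

lemma schrodinger_inner_imaginary:
  assumes V: "bounded (range V)"
  shows "(\<i> *\<^sub>C schrodinger V f) \<bullet> f = 0"
  using inner_imaginary_unit[of f "schrodinger V f"] inner_imaginary_unit[of "schrodinger V f" f]
    schrodinger_symmetric[OF V, of f "\<i> *\<^sub>C f"] schrodinger_scaleC[OF V, of \<i> f]
  by (simp add: inner_commute)

lemma evolution_eq: "evolution V t = op_exp (t *\<^sub>R (scalar_op (- \<i>) o\<^sub>L schrodinger V))"
  unfolding evolution_def
  by (rule arg_cong[of _ _ op_exp], rule blinfun_eqI, rule ell2_eqI)
    (simp add: scalar_op.rep_eq blinfun.scaleR_left scaleR_conv_of_real)

lemma evolution_has_vector_derivative:
  "((\<lambda>t. evolution V t f) has_vector_derivative (- \<i>) *\<^sub>C schrodinger V (evolution V t f)) (at t)"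
  using op_exp_scaleR_has_vector_derivative[of "scalar_op (- \<i>) o\<^sub>L schrodinger V" f t]
  by (simp add: evolution_eq scalar_op.rep_eq)

lemma norm_evolution:
  assumes "bounded (range V)"
  shows "norm (evolution V t f) = norm f"
  unfolding evolution_eq
  by (rule norm_op_exp_antisymmetric)
    (simp add: scalar_op.rep_eq scaleC_minus_left schrodinger_inner_imaginary[OF assms])

lemma evolution_0: "evolution V 0 f = f"
  by (simp add: evolution_eq op_exp_zero)

text \<open>Unless H = 0, one of the two numbers of modulus \<open>norm H\<close> on the real axis
  is spectral, so the spectral enclosure becomes the norm bound that the Neumann series
  uses.\<close>

lemma norm_schrodinger_le:
  assumes V: "bounded (range V)" and "r \<ge> 0"
    and spec: "op_spectrum (schrodinger V) \<subseteq> complex_of_real ` {- r..r}"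
  shows "norm (schrodinger V) \<le> r"
proof (rule ccontr)
  assume "\<not> norm (schrodinger V) \<le> r"
  then have "complex_of_real (norm (schrodinger V)) \<notin> complex_of_real ` {- r..r}"
    "- complex_of_real (norm (schrodinger V)) \<notin> complex_of_real ` {- r..r}"
    by (auto simp flip: of_real_minus)
  then have "schrodinger V = 0"
    using spec by (intro eq_0_if_norm_notin_spectrum schrodinger_symmetric[OF V]) auto
  then show False using \<open>\<not> norm (schrodinger V) \<le> r\<close> \<open>r \<ge> 0\<close> by simp
qed

lemma ell2_nth_delta [simp]: "ell2_nth (delta a) n = (if n = a then 1 else 0)"
  by transfer simp

lemma norm_delta: "norm (delta a) = 1"
proof -
  have "(\<Sum>\<^sub>\<infinity>n. (cmod (ell2_nth (delta a) n))\<^sup>2) = (\<Sum>\<^sub>\<infinity>n\<in>{a}. 1)"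
    by (rule infsum_cong_neutral) auto
  then show ?thesis by (simp add: norm_ell2_def)
qed

lemma cinner_delta: "cinner f (delta n) = cnj (ell2_nth f n)"
proof -
  have "cinner f (delta n) = (\<Sum>\<^sub>\<infinity>k\<in>{n}. cnj (ell2_nth f k))"
    unfolding cinner_def by (rule infsum_cong_neutral) auto
  then show ?thesis by simp
qed

text \<open>Two-sided inverses are unique, so the choice is forced off the spectrum; on the spectrum
  the value is arbitrary.\<close>

definition resolvent :: "(int \<Rightarrow> real) \<Rightarrow> complex \<Rightarrow> ell2 \<Rightarrow>\<^sub>L ell2"
  where "resolvent V z = (SOME B. (schrodinger V - scalar_op z) o\<^sub>L B = id_blinfun
                                  \<and> B o\<^sub>L (schrodinger V - scalar_op z) = id_blinfun)"

lemma
  assumes "z \<notin> op_spectrum (schrodinger V)"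
  shows resolvent_right: "schrodinger V (resolvent V z f) - z *\<^sub>C resolvent V z f = f"
    and resolvent_left: "resolvent V z (schrodinger V f - z *\<^sub>C f) = f"
proof -
  have *: "(schrodinger V - scalar_op z) o\<^sub>L resolvent V z = id_blinfun
      \<and> resolvent V z o\<^sub>L (schrodinger V - scalar_op z) = id_blinfun"
    unfolding resolvent_def by (rule someI_ex) (use assms in \<open>simp add: op_spectrum_def\<close>)
  show "schrodinger V (resolvent V z f) - z *\<^sub>C resolvent V z f = f"
    using arg_cong[OF conjunct1[OF *], of "\<lambda>B. blinfun_apply B f"]
    by (simp add: blinfun.diff_left scalar_op.rep_eq)
  show "resolvent V z (schrodinger V f - z *\<^sub>C f) = f"
    using arg_cong[OF conjunct2[OF *], of "\<lambda>B. blinfun_apply B f"]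
    by (simp add: blinfun.diff_left scalar_op.rep_eq)
qed

section \<open>Resolvent bounds and decay of the Green function\<close>

locale schrodinger_operator =
  fixes V :: "int \<Rightarrow> real" and K :: real
  assumes V: "bounded (range V)" and K: "K \<ge> 1"
    and spectrum: "op_spectrum (schrodinger V) \<subseteq> complex_of_real ` {- K + 1 .. K - 1}"
begin

text \<open>The source comes first: \<open>green z a n\<close> is the kernel G(n,a;z).\<close>

definition green :: "complex \<Rightarrow> int \<Rightarrow> int \<Rightarrow> complex"
  where "green z a = ell2_nth (resolvent V z (delta a))"

lemma not_in_spectrum: "Im z > 0 \<Longrightarrow> z \<notin> op_spectrum (schrodinger V)"
  using spectrum by auto

lemma resolvent_eqI:
  assumes "Im z > 0" "schrodinger V g - z *\<^sub>C g = f"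
  shows "resolvent V z f = g"
  using resolvent_left[OF not_in_spectrum[OF assms(1)]] assms(2) by metis

text \<open>The type of the inverse gives real linearity only; complex linearity is inherited from H
  by uniqueness of the solution.\<close>

lemma resolvent_scaleC:
  assumes z: "Im z > 0"
  shows "resolvent V z (c *\<^sub>C f) = c *\<^sub>C resolvent V z f"
proof (rule resolvent_eqI[OF z])
  have "schrodinger V (c *\<^sub>C resolvent V z f) - z *\<^sub>C c *\<^sub>C resolvent V z f
      = c *\<^sub>C (schrodinger V (resolvent V z f) - z *\<^sub>C resolvent V z f)"
    by (rule ell2_eqI) (simp add: schrodinger_scaleC[OF V] algebra_simps)
  then show "schrodinger V (c *\<^sub>C resolvent V z f) - z *\<^sub>C c *\<^sub>C resolvent V z f = c *\<^sub>C f"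
    by (simp add: resolvent_right[OF not_in_spectrum[OF z]])
qed

text \<open>Pairing f = (H - z)u with iu kills the contributions of Hu and of Re z, leaving - Im z
  times the squared norm of u; Cauchy-Schwarz finishes.\<close>

lemma norm_resolvent_le_Im:
  assumes z: "Im z > 0"
  shows "Im z * norm (resolvent V z f) \<le> norm f"
proof -
  define u where "u = resolvent V z f"
  have f: "f = schrodinger V u - z *\<^sub>C u"
    unfolding u_def by (simp add: resolvent_right[OF not_in_spectrum[OF z]])
  have zu: "z *\<^sub>C u = Re z *\<^sub>R u + Im z *\<^sub>R (\<i> *\<^sub>C u)"
    by (rule ell2_eqI, subst complex_eq[of z]) (simp add: scaleR_conv_of_real algebra_simps)
  have uu: "u \<bullet> (\<i> *\<^sub>C u) = 0"
    using inner_imaginary_unit[of u u] by (simp add: inner_commute)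
  have uH: "schrodinger V u \<bullet> (\<i> *\<^sub>C u) = 0"
    using inner_imaginary_unit[of "schrodinger V u" u] schrodinger_inner_imaginary[OF V, of u] by simp
  have ii: "(\<i> *\<^sub>C u) \<bullet> (\<i> *\<^sub>C u) = (norm u)\<^sup>2"
    by (simp add: norm_scaleC_ell2 flip: power2_norm_eq_inner)
  have "f \<bullet> (\<i> *\<^sub>C u) = - Im z * (norm u)\<^sup>2"
    unfolding f zu by (simp add: inner_diff_left inner_add_left uu uH ii)
  then have "Im z * (norm u)\<^sup>2 \<le> norm f * norm (\<i> *\<^sub>C u)"
    using Cauchy_Schwarz_ineq2[of f "\<i> *\<^sub>C u"] by simp
  then have "Im z * norm u * norm u \<le> norm f * norm u"
    by (simp add: norm_scaleC_ell2 power2_eq_square mult_ac)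
  then show ?thesis
    unfolding u_def[symmetric] by (cases "norm u = 0") (auto simp: mult_le_cancel_right)
qed

lemma norm_schrodinger_apply_le: "norm (schrodinger V f) \<le> (K - 1) * norm f"
proof -
  have "norm (schrodinger V) \<le> K - 1"
    using norm_schrodinger_le[OF V, of "K - 1"] K spectrum by simp
  then show ?thesis
    using order_trans[OF norm_blinfun mult_right_mono] norm_ge_zero by blast
qed

text \<open>For |z| > K - 1 this is a bound free of Im z, so the large energies contribute no power
  of T through the resolvent.\<close>

lemma norm_resolvent_le_cmod:
  assumes z: "Im z > 0"
  shows "(cmod z - (K - 1)) * norm (resolvent V z f) \<le> norm f"
proof -
  define u where "u = resolvent V z f"
  have f: "f = schrodinger V u - z *\<^sub>C u"
    unfolding u_def by (simp add: resolvent_right[OF not_in_spectrum[OF z]])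
  have "cmod z * norm u = norm (z *\<^sub>C u)" by (simp add: norm_scaleC_ell2)
  also have "z *\<^sub>C u = schrodinger V u - f" by (simp add: f)
  also have "norm \<dots> \<le> (K - 1) * norm u + norm f"
    using norm_triangle_ineq4[of "schrodinger V u" f] norm_schrodinger_apply_le[of u] by linarith
  finally show ?thesis by (simp add: u_def algebra_simps)
qed

lemma green_eq:
  assumes "Im z > 0"
  shows "green z a (n + 1) + green z a (n - 1) + (of_real (V n) - z) * green z a n
    = (if n = a then 1 else 0)"
  using arg_cong[OF resolvent_right[OF not_in_spectrum[OF assms], of "delta a"], of "\<lambda>f. ell2_nth f n"]
  by (simp add: green_def schrodinger_nth[OF V] algebra_simps)

lemma sum_green_le:
  assumes "Im z > 0" "finite F"
  shows "(\<Sum>n\<in>F. (cmod (green z a n))\<^sup>2) \<le> (1 / Im z)\<^sup>2"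
proof -
  have "norm (resolvent V z (delta a)) \<le> 1 / Im z"
    using norm_resolvent_le_Im[OF assms(1), of "delta a"] assms(1)
    by (simp add: norm_delta pos_le_divide_eq mult.commute)
  then have "(norm (resolvent V z (delta a)))\<^sup>2 \<le> (1 / Im z)\<^sup>2"
    by (intro power_mono) auto
  then show ?thesis
    using sum_le_norm_ell2_square[OF assms(2), of "resolvent V z (delta a)"]
    unfolding green_def by linarith
qed

text \<open>Outside the \<open>j\<close>-neighbourhood of the source only the \<open>j\<close>-th remainder of the Neumann
  series \<open>u = - \<delta>\<^sub>1 / z - H \<delta>\<^sub>1 / z\<^sup>2 - \<dots>\<close> contributes.\<close>

lemma green_remainder:
  assumes z: "Im z > 0"
  shows "\<exists>w. norm w \<le> ((K - 1) / cmod z) ^ j * norm (resolvent V z (delta a))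
    \<and> (\<forall>n. \<bar>n - a\<bar> \<ge> int j \<longrightarrow> green z a n = ell2_nth w n)"
proof (induction j)
  case 0
  show ?case by (rule exI[of _ "resolvent V z (delta a)"]) (simp add: green_def)
next
  case (Suc j)
  then obtain w where w: "norm w \<le> ((K - 1) / cmod z) ^ j * norm (resolvent V z (delta a))"
    and w_eq: "\<And>n. \<bar>n - a\<bar> \<ge> int j \<Longrightarrow> green z a n = ell2_nth w n" by auto
  have z0: "z \<noteq> 0" using z by auto
  \<comment> \<open>Off the source the equation reads zu = Hu, and H reaches only nearest
    neighbours: each factor H/z costs one unit of distance.\<close>
  show ?case
  proof (intro exI[of _ "(1 / z) *\<^sub>C schrodinger V w"] conjI allI impI)
    have "norm ((1 / z) *\<^sub>C schrodinger V w) \<le> (1 / cmod z) * ((K - 1) * norm w)"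
      using norm_schrodinger_apply_le[of w]
      by (simp add: norm_scaleC_ell2 norm_divide divide_right_mono)
    also have "\<dots> \<le> (1 / cmod z) * ((K - 1) * (((K - 1) / cmod z) ^ j * norm (resolvent V z (delta a))))"
      using w K by (intro mult_left_mono) auto
    finally show "norm ((1 / z) *\<^sub>C schrodinger V w)
        \<le> ((K - 1) / cmod z) ^ Suc j * norm (resolvent V z (delta a))" by (simp add: mult_ac)
    fix n assume n: "int (Suc j) \<le> \<bar>n - a\<bar>"
    have "green z a (n + 1) + green z a (n - 1) + of_real (V n) * green z a n = z * green z a n"
      using green_eq[OF z, of a n] n by (auto simp: algebra_simps split: if_splits)
    moreover have "green z a (n + 1) = ell2_nth w (n + 1)" "green z a (n - 1) = ell2_nth w (n - 1)"
        "green z a n = ell2_nth w n"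
      using n by (intro w_eq; linarith)+
    ultimately show "green z a n = ell2_nth ((1 / z) *\<^sub>C schrodinger V w) n"
      using z0 by (simp add: schrodinger_nth[OF V] field_simps)
  qed
qed

lemma sum_green_tail_le:
  assumes z: "Im z > 0" "cmod z > K - 1" and F: "finite F" "\<And>n. n \<in> F \<Longrightarrow> \<bar>n - a\<bar> \<ge> int j"
  shows "(\<Sum>n\<in>F. (cmod (green z a n))\<^sup>2) \<le> (((K - 1) / cmod z) ^ j / (cmod z - (K - 1)))\<^sup>2"
proof -
  obtain w where w: "norm w \<le> ((K - 1) / cmod z) ^ j * norm (resolvent V z (delta a))"
    and w_eq: "\<And>n. \<bar>n - a\<bar> \<ge> int j \<Longrightarrow> green z a n = ell2_nth w n"
    using green_remainder[OF z(1), of j a] by blast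
  have "norm (resolvent V z (delta a)) \<le> 1 / (cmod z - (K - 1))"
    using norm_resolvent_le_cmod[OF z(1), of "delta a"] z(2)
    by (simp add: norm_delta pos_le_divide_eq mult.commute)
  then have "norm w \<le> ((K - 1) / cmod z) ^ j * (1 / (cmod z - (K - 1)))"
    using K by (intro order_trans[OF w] mult_left_mono) auto
  then have "(norm w)\<^sup>2 \<le> (((K - 1) / cmod z) ^ j / (cmod z - (K - 1)))\<^sup>2"
    by (intro power_mono) auto
  moreover have "(\<Sum>n\<in>F. (cmod (green z a n))\<^sup>2) = (\<Sum>n\<in>F. (cmod (ell2_nth w n))\<^sup>2)"
    using F(2) w_eq by (intro sum.cong) auto
  ultimately show ?thesis
    using sum_le_norm_ell2_square[OF F(1), of w] by linarith
qed

end

section \<open>Wronskians and transfer matrices\<close>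

context schrodinger_operator begin

definition wronskian :: "complex \<Rightarrow> int \<Rightarrow> int \<Rightarrow> int \<Rightarrow> complex"
  where "wronskian z a b k = green z a (k + 1) * green z b k - green z a k * green z b (k + 1)"

text \<open>Off the sources both sequences satisfy the same recurrence, so V and z cancel and only
  the sources produce jumps.\<close>

lemma wronskian_step:
  assumes z: "Im z > 0"
  shows "wronskian z a b k - wronskian z a b (k - 1)
    = (if k = a then green z b k else 0) - (if k = b then green z a k else 0)"
proof -
  have u: "green z a (k + 1) = (if k = a then 1 else 0) - green z a (k - 1) - (of_real (V k) - z) * green z a k"
    using green_eq[OF z, of a k] by (simp add: algebra_simps)
  have v: "green z b (k + 1) = (if k = b then 1 else 0) - green z b (k - 1) - (of_real (V k) - z) * green z b k"
    using green_eq[OF z, of b k] by (simp add: algebra_simps)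
  show ?thesis
    unfolding wronskian_def u v by (simp add: algebra_simps)
qed

text \<open>Both factors are square summable, so the Wronskian cannot keep a nonzero value on an
  infinite set.\<close>

lemma wronskian_infinitely_often:
  assumes z: "Im z > 0" and S: "infinite S" "\<And>k. k \<in> S \<Longrightarrow> wronskian z a b k = c"
  shows "c = 0"
proof (rule ccontr)
  assume "c \<noteq> 0"
  define \<tau> where "\<tau> = (1 / Im z)\<^sup>2"
  \<comment> \<open>Four sums of squares over F occur below, each at most
    \<open>\<tau>\<close>.\<close>
  obtain n where n: "real n * cmod c > 4 * \<tau>"
    using \<open>c \<noteq> 0\<close> reals_Archimedean3[of "cmod c"] by auto
  obtain F where F: "F \<subseteq> S" "finite F" "card F = n"
    using S(1) infinite_arbitrarily_large by blast
  have F': "(\<Sum>k\<in>F. (cmod (green z d (k + 1)))\<^sup>2) \<le> \<tau>" for d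
    using sum_green_le[OF z, of "(\<lambda>k. k + 1) ` F" d] F(2) by (simp add: sum.reindex \<tau>_def)
  have F0: "(\<Sum>k\<in>F. (cmod (green z d k))\<^sup>2) \<le> \<tau>" for d
    using sum_green_le[OF z F(2)] by (simp add: \<tau>_def)
  have "cmod c \<le> (cmod (green z a (k + 1)))\<^sup>2 + (cmod (green z b k))\<^sup>2
      + ((cmod (green z a k))\<^sup>2 + (cmod (green z b (k + 1)))\<^sup>2)" if "k \<in> F" for k
  proof -
    have p: "cmod (x * y) \<le> (cmod x)\<^sup>2 + (cmod y)\<^sup>2" for x y
      using sum_squares_bound[of "cmod x" "cmod y"]
        mult_nonneg_nonneg[OF norm_ge_zero[of x] norm_ge_zero[of y]] unfolding norm_mult by linarith
    have "cmod c = cmod (wronskian z a b k)" using S(2) F(1) that by auto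
    also have "\<dots> \<le> cmod (green z a (k + 1) * green z b k) + cmod (green z a k * green z b (k + 1))"
      unfolding wronskian_def by (rule norm_triangle_ineq4)
    also have "\<dots> \<le> (cmod (green z a (k + 1)))\<^sup>2 + (cmod (green z b k))\<^sup>2
      + ((cmod (green z a k))\<^sup>2 + (cmod (green z b (k + 1)))\<^sup>2)"
      by (intro add_mono p)
    finally show ?thesis .
  qed
  then have "(\<Sum>k\<in>F. cmod c) \<le> (\<Sum>k\<in>F. (cmod (green z a (k + 1)))\<^sup>2 + (cmod (green z b k))\<^sup>2
      + ((cmod (green z a k))\<^sup>2 + (cmod (green z b (k + 1)))\<^sup>2))"
    by (rule sum_mono)
  also have "\<dots> \<le> 4 * \<tau>"
    using F'[of a] F'[of b] F0[of a] F0[of b] by (simp add: sum.distrib)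
  finally show False using n F(3) by simp
qed

text \<open>The Wronskian is constant on each of the three intervals cut out by a and b, and zero on
  the two unbounded ones. The jump at a gives the middle value, the jump at b the symmetry of
  G.\<close>

lemma wronskian_values:
  assumes z: "Im z > 0" and ab: "a < b"
  shows "k < a \<Longrightarrow> wronskian z a b k = 0"
    and "a \<le> k \<Longrightarrow> k < b \<Longrightarrow> wronskian z a b k = green z b a"
    and "green z a b = green z b a"
proof -
  have low: "wronskian z a b k = wronskian z a b (a - 1)" if "k \<le> a - 1" for k
    using that
  proof (induction k rule: int_le_induct)
    case (step i)
    then show ?case using wronskian_step[OF z, of a b i] ab by simp
  qed simp
  have low0: "wronskian z a b (a - 1) = 0"
    by (rule wronskian_infinitely_often[OF z infinite_Iic[of "a - 1"]]) (rule low, simp)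
  show *: "wronskian z a b k = 0" if "k < a" for k
    by (rule trans[OF low low0]) (use that in simp)
  have mid: "k < b \<longrightarrow> wronskian z a b k = green z b a" if "a \<le> k" for k
    using that
  proof (induction k rule: int_ge_induct)
    case base
    then show ?case using wronskian_step[OF z, of a b a] *[of "a - 1"] ab by simp
  next
    case (step i)
    then show ?case using wronskian_step[OF z, of a b "i + 1"] by (auto split: if_splits)
  qed
  then show "a \<le> k \<Longrightarrow> k < b \<Longrightarrow> wronskian z a b k = green z b a" by blast
  have high: "wronskian z a b k = wronskian z a b b" if "b \<le> k" for k
    using that
  proof (induction k rule: int_ge_induct)
    case (step i)
    then show ?case using wronskian_step[OF z, of a b "i + 1"] ab by simp
  qed simp
  have "wronskian z a b b = 0"
    by (rule wronskian_infinitely_often[OF z infinite_Ici[of b]]) (rule high, simp)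
  then show "green z a b = green z b a"
    using wronskian_step[OF z, of a b b] mid[of "b - 1"] ab by simp
qed

lemma green_symmetric: "Im z > 0 \<Longrightarrow> green z a b = green z b a"
  by (cases a b rule: linorder_cases) (blast dest: wronskian_values(3) sym)+

end

section \<open>Transfer matrices acting on solutions, and operator norms through columns\<close>

lemma transfer_step_mult: "transfer_step V m z *v vector [x, y] = vector [(z - of_real (V m)) * x - y, x]"
  by (simp add: transfer_step_def matrix_vector_mult_def vec_eq_iff forall_2 sum_2)

lemma matrix_inv_transfer_step:
  "matrix_inv (transfer_step V m z) = vector [vector [0, 1], vector [-1, z - of_real (V m)]]"
proof -
  let ?B = "vector [vector [0, 1], vector [-1, z - of_real (V m)]] :: complex^2^2"
  have AB: "transfer_step V m z ** ?B = mat 1" and BA: "?B ** transfer_step V m z = mat 1"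
    by (simp_all add: transfer_step_def matrix_matrix_mult_def mat_def vec_eq_iff forall_2 sum_2)
  have "transfer_step V m z ** matrix_inv (transfer_step V m z) = mat 1"
    unfolding matrix_inv_def by (rule someI2_ex) (use AB BA in auto)
  then have "?B ** (transfer_step V m z ** matrix_inv (transfer_step V m z)) = ?B" by simp
  then show ?thesis by (simp add: matrix_mul_assoc BA)
qed

lemma matrix_inv_transfer_step_mult:
  "matrix_inv (transfer_step V m z) *v vector [x, y] = vector [y, (z - of_real (V m)) * y - x]"
  by (simp add: matrix_inv_transfer_step matrix_vector_mult_def vec_eq_iff forall_2 sum_2)

text \<open>The equation is required exactly at the sites crossed, 1 to n, so a source beyond n is
  harmless.\<close>

lemma transfer_pos_mult:
  assumes "\<And>k. 1 \<le> k \<Longrightarrow> k \<le> int n \<Longrightarrow> f (k + 1) + f (k - 1) + (of_real (V k) - z) * f k = 0"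
  shows "transfer_pos V n z *v vector [f 1, f 0] = vector [f (int n + 1), f (int n)]"
  using assms
proof (induction n)
  case (Suc n)
  have "f (int (Suc n) + 1) = (z - of_real (V (int (Suc n)))) * f (int (Suc n)) - f (int n)"
    using Suc.prems[of "int (Suc n)"] by (simp add: algebra_simps)
  moreover have "transfer_pos V n z *v vector [f 1, f 0] = vector [f (int n + 1), f (int n)]"
    by (rule Suc.IH) (rule Suc.prems, auto)
  moreover have "int (Suc n) = int n + 1" by simp
  ultimately show ?case
    by (simp only: transfer_pos.simps matrix_vector_mul_assoc[symmetric] transfer_step_mult)
qed simp

text \<open>Going left, the sites crossed end at 0, which leaves the source at 1 outside.\<close>

lemma transfer_neg_mult:
  assumes "\<And>k. 1 - int n \<le> k \<Longrightarrow> k \<le> 0 \<Longrightarrow> f (k + 1) + f (k - 1) + (of_real (V k) - z) * f k = 0"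
  shows "transfer_neg V n z *v vector [f 1, f 0] = vector [f (1 - int n), f (- int n)]"
  using assms
proof (induction n)
  case (Suc n)
  have idx: "- int n - 1 = - int (Suc n)" "- int n + 1 = 1 - int n" by simp_all
  have "f (- int n + 1) + f (- int n - 1) + (of_real (V (- int n)) - z) * f (- int n) = 0"
    by (rule Suc.prems) auto
  then have "f (1 - int n) + f (- int (Suc n)) + (of_real (V (- int n)) - z) * f (- int n) = 0"
    by (simp only: idx)
  then have "f (- int (Suc n)) = (z - of_real (V (- int n))) * f (- int n) - f (1 - int n)"
    by algebra
  moreover have "transfer_neg V n z *v vector [f 1, f 0] = vector [f (1 - int n), f (- int n)]"
    by (rule Suc.IH) (rule Suc.prems, auto)
  moreover have "1 - int (Suc n) = - int n" by simp
  ultimately show ?case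
    by (simp only: transfer_neg.simps matrix_vector_mul_assoc[symmetric] matrix_inv_transfer_step_mult)
qed simp

lemma norm_vec2: "(norm (x :: complex^2))\<^sup>2 = (cmod (x $ 1))\<^sup>2 + (cmod (x $ 2))\<^sup>2"
  by (simp add: norm_vec_def L2_set_def sum_2)

lemma norm_mult_le_op_norm: "norm (A *v x) \<le> op_norm A * norm x"
  unfolding op_norm_def by (rule onorm) simp

lemma op_norm_nonneg: "0 \<le> op_norm A"
  unfolding op_norm_def by (rule onorm_pos_le) simp

lemma norm_mult_vector:
  fixes A :: "complex^2^2"
  shows "norm (A *v vector [0, s]) = cmod s * norm (A *v vector [0, 1 :: complex])"
    and "norm (A *v vector [s, 0]) = cmod s * norm (A *v vector [1, 0 :: complex])"
proof -
  have c: "(A *v vector [0, r]) $ i = A $ i $ 2 * r" "(A *v vector [r, 0]) $ i = A $ i $ 1 * r" for i r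
    by (simp_all add: matrix_vector_mult_def sum_2)
  have "(norm (A *v vector [0, s]))\<^sup>2 = (cmod s * norm (A *v vector [0, 1]))\<^sup>2"
    "(norm (A *v vector [s, 0]))\<^sup>2 = (cmod s * norm (A *v vector [1, 0]))\<^sup>2"
    unfolding power_mult_distrib norm_vec2 c by (simp_all add: norm_mult power_mult_distrib algebra_simps)
  then show "norm (A *v vector [0, s]) = cmod s * norm (A *v vector [0, 1 :: complex])"
    "norm (A *v vector [s, 0]) = cmod s * norm (A *v vector [1, 0 :: complex])"
    by (auto intro: power2_eq_imp_eq)
qed

lemma op_norm_le_columns:
  "op_norm A \<le> norm (A *v vector [1, 0 :: complex]) + norm (A *v vector [0, 1 :: complex])"
  unfolding op_norm_def
proof (rule onorm_bound)
  fix x :: "complex^2"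
  have c: "cmod (x $ i) \<le> norm x" for i by (rule Finite_Cartesian_Product.norm_nth_le)
  have "x = vector [x $ 1, 0] + vector [0, x $ 2]" by (simp add: vec_eq_iff forall_2)
  then have "A *v x = A *v vector [x $ 1, 0] + A *v vector [0, x $ 2]"
    by (metis matrix_vector_right_distrib)
  then have "norm (A *v x) \<le> norm (A *v vector [x $ 1, 0]) + norm (A *v vector [0, x $ 2])"
    by (simp add: norm_triangle_ineq)
  also have "\<dots> = cmod (x $ 1) * norm (A *v vector [1, 0]) + cmod (x $ 2) * norm (A *v vector [0, 1])"
    using norm_mult_vector by metis
  also have "\<dots> \<le> norm x * norm (A *v vector [1, 0]) + norm x * norm (A *v vector [0, 1])"
    by (intro add_mono mult_right_mono c) auto
  finally show "norm (A *v x) \<le> (norm (A *v vector [1, 0]) + norm (A *v vector [0, 1])) * norm x"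
    by (simp add: algebra_simps)
qed simp

lemma op_norm_square_le_columns:
  "(op_norm A)\<^sup>2 \<le> 2 * (norm (A *v vector [1, 0 :: complex]))\<^sup>2 + 2 * (norm (A *v vector [0, 1 :: complex]))\<^sup>2"
proof -
  have "(op_norm A)\<^sup>2 \<le> (norm (A *v vector [1, 0 :: complex]) + norm (A *v vector [0, 1 :: complex]))\<^sup>2"
    by (rule power_mono[OF op_norm_le_columns op_norm_nonneg])
  then show ?thesis
    using sum_squares_bound[of "norm (A *v vector [1, 0 :: complex])" "norm (A *v vector [0, 1 :: complex])"]
    by (simp add: power2_sum)
qed

text \<open>The estimate shared by all four columns, two in each direction: \<open>\<alpha>\<close>
  is fixed while \<open>p\<close>, \<open>q\<close> and \<open>\<beta>\<close> are square summable
  in m. The allowance of 2 \<open>\<tau>\<close> for \<open>\<alpha>\<close> leaves room for 1 -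
  G(0,1).\<close>

lemma sum_columns_le:
  fixes A :: "complex^2^2" and \<tau> :: real
  assumes eq: "\<And>m. m \<in> F \<Longrightarrow> cmod (s m) * c = norm (vector [\<alpha> * p m + \<beta> m * x, \<alpha> * q m + \<beta> m * y] :: complex^2)"
    and \<alpha>: "cmod \<alpha> \<le> 2 * \<tau>"
    and sums: "(\<Sum>m\<in>F. (cmod (p m))\<^sup>2) \<le> \<tau>\<^sup>2" "(\<Sum>m\<in>F. (cmod (q m))\<^sup>2) \<le> \<tau>\<^sup>2"
      "(\<Sum>m\<in>F. (cmod (\<beta> m))\<^sup>2) \<le> \<tau>\<^sup>2"
    and xy: "(cmod x)\<^sup>2 \<le> \<tau>\<^sup>2" "(cmod y)\<^sup>2 \<le> \<tau>\<^sup>2"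
  shows "c\<^sup>2 * (\<Sum>m\<in>F. (cmod (s m))\<^sup>2) \<le> 20 * \<tau> ^ 4"
proof -
  have \<alpha>2: "(cmod \<alpha>)\<^sup>2 \<le> 4 * \<tau>\<^sup>2"
    using power_mono[OF \<alpha> norm_ge_zero, of 2] by (simp add: power_mult_distrib)
  \<comment> \<open>Splitting a square costs a factor 2: with \<open>(cmod \<alpha>)\<^sup>2\<close>
    at most 4 \<open>\<tau>\<^sup>2\<close> this gives 8 for each coordinate, and the
    \<open>\<beta>\<close> term occurs in both, giving 2 + 2. The total is 20.\<close>
  have bnd: "(cmod (s m) * c)\<^sup>2 \<le> 8 * \<tau>\<^sup>2 * (cmod (p m))\<^sup>2 + 8 * \<tau>\<^sup>2 * (cmod (q m))\<^sup>2 + 4 * \<tau>\<^sup>2 * (cmod (\<beta> m))\<^sup>2"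
    if "m \<in> F" for m
  proof -
    have 1: "(cmod (\<alpha> * r + \<beta> m * w))\<^sup>2 \<le> 8 * \<tau>\<^sup>2 * (cmod r)\<^sup>2 + 2 * \<tau>\<^sup>2 * (cmod (\<beta> m))\<^sup>2"
      if w: "(cmod w)\<^sup>2 \<le> \<tau>\<^sup>2" for r w
    proof -
      have "(cmod (\<alpha> * r + \<beta> m * w))\<^sup>2 \<le> 2 * (cmod (\<alpha> * r))\<^sup>2 + 2 * (cmod (\<beta> m * w))\<^sup>2"
        by (rule cmod_add_square_le)
      also have "\<dots> = 2 * ((cmod \<alpha>)\<^sup>2 * (cmod r)\<^sup>2) + 2 * ((cmod w)\<^sup>2 * (cmod (\<beta> m))\<^sup>2)"
        by (simp add: norm_mult power_mult_distrib mult.commute)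
      also have "\<dots> \<le> 2 * (4 * \<tau>\<^sup>2 * (cmod r)\<^sup>2) + 2 * (\<tau>\<^sup>2 * (cmod (\<beta> m))\<^sup>2)"
        by (intro add_mono mult_left_mono mult_right_mono \<alpha>2 w) auto
      finally show ?thesis by simp
    qed
    show ?thesis
      unfolding eq[OF that] norm_vec2 using 1[OF xy(1), of "p m"] 1[OF xy(2), of "q m"] by simp
  qed
  have "c\<^sup>2 * (\<Sum>m\<in>F. (cmod (s m))\<^sup>2) = (\<Sum>m\<in>F. (cmod (s m) * c)\<^sup>2)"
    by (simp add: sum_distrib_left power_mult_distrib mult.commute)
  also have "\<dots> \<le> (\<Sum>m\<in>F. 8 * \<tau>\<^sup>2 * (cmod (p m))\<^sup>2 + 8 * \<tau>\<^sup>2 * (cmod (q m))\<^sup>2 + 4 * \<tau>\<^sup>2 * (cmod (\<beta> m))\<^sup>2)"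
    by (rule sum_mono) (rule bnd)
  also have "\<dots> = 8 * \<tau>\<^sup>2 * (\<Sum>m\<in>F. (cmod (p m))\<^sup>2) + 8 * \<tau>\<^sup>2 * (\<Sum>m\<in>F. (cmod (q m))\<^sup>2)
      + 4 * \<tau>\<^sup>2 * (\<Sum>m\<in>F. (cmod (\<beta> m))\<^sup>2)"
    by (simp add: sum.distrib sum_distrib_left)
  also have "\<dots> \<le> 8 * \<tau>\<^sup>2 * \<tau>\<^sup>2 + 8 * \<tau>\<^sup>2 * \<tau>\<^sup>2 + 4 * \<tau>\<^sup>2 * \<tau>\<^sup>2"
    by (intro add_mono mult_left_mono sums) auto
  finally show ?thesis by (simp add: power4_eq_xxxx power2_eq_square)
qed

context schrodinger_operator begin

lemma cmod_green_square_le: "Im z > 0 \<Longrightarrow> (cmod (green z a n))\<^sup>2 \<le> (1 / Im z)\<^sup>2"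
  using sum_green_le[of z "{n}" a] by simp

lemma cmod_green_le: "Im z > 0 \<Longrightarrow> cmod (green z a n) \<le> 1 / Im z"
  by (rule power2_le_imp_le[OF cmod_green_square_le]) auto

text \<open>The vectors \<open>(G(1,1), G(0,1) - 1)\<close> and \<open>(G(1,m), G(0,m))\<close> evolve under the transfer matrices
  up to site \<open>m\<close>, and by the Wronskian identity \<open>G(1,m)\<close> times either standard basis vector is a
  combination of the two with coefficients that are again Green function values.\<close>

lemma sum_green_right_le:
  assumes z: "0 < Im z" "Im z \<le> 1" and n: "n \<ge> 1" and F: "finite F" "\<And>m. m \<in> F \<Longrightarrow> m > n"
  shows "(op_norm (transfer V n z))\<^sup>2 * (\<Sum>m\<in>F. (cmod (green z 1 m))\<^sup>2) \<le> 80 * (1 / Im z) ^ 4"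
proof -
  define \<tau> where "\<tau> = 1 / Im z"
  have \<tau>: "\<tau> \<ge> 1" using z by (simp add: \<tau>_def)
  define A where "A = transfer V n z"
  \<comment> \<open>Site 0 enters the equation at site 1 as left neighbour, so lowering the value
    there by 1 cancels the source at 1.\<close>
  define u where "u = (green z 1)(0 := green z 1 0 - 1)"
  have propagate: "A *v vector [a * green z m 1 + b * u 1, a * green z m 0 + b * u 0]
      = vector [a * green z m (n + 1) + b * green z 1 (n + 1), a * green z m n + b * green z 1 n]"
    if m: "m > n" for m a b
  proof -
    define f where "f = (\<lambda>k. a * green z m k + b * u k)"
    have "f (k + 1) + f (k - 1) + (of_real (V k) - z) * f k = 0" if k: "1 \<le> k" "k \<le> int (nat n)" for k
    proof -
      have "u (k + 1) + u (k - 1) + (of_real (V k) - z) * u k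
          = (green z 1 (k + 1) + green z 1 (k - 1) + (of_real (V k) - z) * green z 1 k) - (if k = 1 then 1 else 0)"
        using k by (simp add: u_def)
      then have "u (k + 1) + u (k - 1) + (of_real (V k) - z) * u k = 0"
        by (simp only: green_eq[OF z(1), of 1 k] diff_self)
      moreover have "green z m (k + 1) + green z m (k - 1) + (of_real (V k) - z) * green z m k = 0"
        using green_eq[OF z(1), of m k] k m n by (auto split: if_splits)
      ultimately show ?thesis unfolding f_def by algebra
    qed
    from transfer_pos_mult[of "nat n" f V z, OF this] show ?thesis
      using n by (simp add: A_def transfer_def f_def u_def)
  qed
  \<comment> \<open>Site 0 lies to the left of both sources 1 and m, where the Wronskian
    vanishes.\<close>
  have W: "green z 1 1 * green z m 0 = green z 1 0 * green z m 1" if "m > n" for m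
    using wronskian_values(1)[OF z(1), of 1 m 0] n that by (simp add: wronskian_def)
  have sym: "green z 1 m = green z m 1" for m by (rule green_symmetric[OF z(1)])
  \<comment> \<open>Symmetry of G turns the sum over sources m into a sum over sites, bounded by an
    l2 norm.\<close>
  have sums: "(\<Sum>m\<in>F. (cmod (green z m k))\<^sup>2) \<le> \<tau>\<^sup>2" for k
    using sum_green_le[OF z(1) F(1), of k] by (simp add: \<tau>_def green_symmetric[OF z(1), of _ k])
  have sums': "(\<Sum>m\<in>F. (cmod (- green z m k))\<^sup>2) \<le> \<tau>\<^sup>2" for k
    using sums[of k] by simp
  have le: "cmod (green z a k) \<le> \<tau>" "(cmod (green z a k))\<^sup>2 \<le> \<tau>\<^sup>2" for a k
    using cmod_green_le[OF z(1)] cmod_green_square_le[OF z(1)] by (auto simp: \<tau>_def)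
  have c2: "(norm (A *v vector [0, 1]))\<^sup>2 * (\<Sum>m\<in>F. (cmod (green z 1 m))\<^sup>2) \<le> 20 * \<tau> ^ 4"
  proof (rule sum_columns_le[OF _ _ sums sums sums' le(2) le(2)])
    fix m assume "m \<in> F"
    then have m: "m > n" by (rule F)
    \<comment> \<open>The coefficients eliminate the first coordinate; in the second one
      \<open>W\<close> cancels everything except the contribution of the 1 subtracted in
      \<open>u\<close>.\<close>
    have "vector [0, green z 1 m] = (vector [green z 1 1 * green z m 1 + - green z m 1 * u 1,
        green z 1 1 * green z m 0 + - green z m 1 * u 0] :: complex^2)"
      using W[OF m] sym[of m] by (simp add: vec_eq_iff forall_2 u_def algebra_simps)
    then show "cmod (green z 1 m) * norm (A *v vector [0, 1]) = norm (vector
        [green z 1 1 * green z m (n + 1) + - green z m 1 * green z 1 (n + 1),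
         green z 1 1 * green z m n + - green z m 1 * green z 1 n] :: complex^2)"
      by (metis norm_mult_vector(1) propagate[OF m])
  qed (use le(1)[of 1 1] \<tau> in simp)
  have c1: "(norm (A *v vector [1, 0]))\<^sup>2 * (\<Sum>m\<in>F. (cmod (green z 1 m))\<^sup>2) \<le> 20 * \<tau> ^ 4"
  proof (rule sum_columns_le[OF _ _ sums sums sums le(2) le(2)])
    fix m assume "m \<in> F"
    then have m: "m > n" by (rule F)
    have "vector [green z 1 m, 0] = (vector [(1 - green z 1 0) * green z m 1 + green z m 0 * u 1,
        (1 - green z 1 0) * green z m 0 + green z m 0 * u 0] :: complex^2)"
      using W[OF m] sym[of m] by (simp add: vec_eq_iff forall_2 u_def algebra_simps)
    then show "cmod (green z 1 m) * norm (A *v vector [1, 0]) = norm (vector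
        [(1 - green z 1 0) * green z m (n + 1) + green z m 0 * green z 1 (n + 1),
         (1 - green z 1 0) * green z m n + green z m 0 * green z 1 n] :: complex^2)"
      by (metis norm_mult_vector(2) propagate[OF m])
  next
    \<comment> \<open>Here Im z <= 1 enters: it absorbs the summand 1 into
      \<open>\<tau>\<close>.\<close>
    show "cmod (1 - green z 1 0) \<le> 2 * \<tau>"
      using norm_triangle_ineq4[of 1 "green z 1 0"] le(1)[of 1 0] \<tau> by simp
  qed
  have "(op_norm A)\<^sup>2 * (\<Sum>m\<in>F. (cmod (green z 1 m))\<^sup>2)
      \<le> (2 * (norm (A *v vector [1, 0]))\<^sup>2 + 2 * (norm (A *v vector [0, 1]))\<^sup>2) * (\<Sum>m\<in>F. (cmod (green z 1 m))\<^sup>2)"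
    by (intro mult_right_mono op_norm_square_le_columns sum_nonneg) simp
  \<comment> \<open>Each column contributes 20, doubled by the passage from columns to the operator
    norm.\<close>
  also have "\<dots> \<le> 80 * \<tau> ^ 4"
    using c1 c2 by (simp add: algebra_simps)
  finally show ?thesis by (simp add: A_def \<tau>_def)
qed

text \<open>The sites crossed, n + 1 to 0, avoid both sources, so G(.,1) propagates uncorrected.
  Site 0 now lies between the sources m and 1, and the Wronskian there equals G(1,m); it plays the
  part of the subtracted 1 on the right.\<close>

lemma sum_green_left_le:
  assumes z: "0 < Im z" "Im z \<le> 1" and n: "n \<le> - 1" and F: "finite F" "\<And>m. m \<in> F \<Longrightarrow> m < n"
  shows "(op_norm (transfer V n z))\<^sup>2 * (\<Sum>m\<in>F. (cmod (green z 1 m))\<^sup>2) \<le> 80 * (1 / Im z) ^ 4"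
proof -
  define \<tau> where "\<tau> = 1 / Im z"
  have \<tau>: "\<tau> \<ge> 1" using z by (simp add: \<tau>_def)
  define A where "A = transfer V n z"
  have propagate: "A *v vector [a * green z m 1 + b * green z 1 1, a * green z m 0 + b * green z 1 0]
      = vector [a * green z m (n + 1) + b * green z 1 (n + 1), a * green z m n + b * green z 1 n]"
    if m: "m < n" for m a b
  proof -
    define f where "f = (\<lambda>k. a * green z m k + b * green z 1 k)"
    have "f (k + 1) + f (k - 1) + (of_real (V k) - z) * f k = 0" if k: "1 - int (nat (- n)) \<le> k" "k \<le> 0" for k
    proof -
      have "green z 1 (k + 1) + green z 1 (k - 1) + (of_real (V k) - z) * green z 1 k = 0"
        using green_eq[OF z(1), of 1 k] k by auto
      moreover have "green z m (k + 1) + green z m (k - 1) + (of_real (V k) - z) * green z m k = 0"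
        using green_eq[OF z(1), of m k] k m n by auto
      ultimately show ?thesis unfolding f_def by algebra
    qed
    from transfer_neg_mult[of "nat (- n)" f V z, OF this] show ?thesis
      using n by (simp add: A_def transfer_def f_def add.commute)
  qed
  have sym: "green z 1 m = green z m 1" for m by (rule green_symmetric[OF z(1)])
  have W: "green z 1 0 * green z m 1 - green z 1 1 * green z m 0 = green z m 1" if "m < n" for m
    using wronskian_values(2)[OF z(1), of m 1 0] n that sym[of m] by (simp add: wronskian_def mult.commute)
  have sums: "(\<Sum>m\<in>F. (cmod (green z m k))\<^sup>2) \<le> \<tau>\<^sup>2" for k
    using sum_green_le[OF z(1) F(1), of k] by (simp add: \<tau>_def green_symmetric[OF z(1), of _ k])
  have sums': "(\<Sum>m\<in>F. (cmod (- green z m k))\<^sup>2) \<le> \<tau>\<^sup>2" for k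
    using sums[of k] by simp
  have le: "cmod (green z a k) \<le> \<tau>" "(cmod (green z a k))\<^sup>2 \<le> \<tau>\<^sup>2" for a k
    using cmod_green_le[OF z(1)] cmod_green_square_le[OF z(1)] by (auto simp: \<tau>_def)
  have c2: "(norm (A *v vector [0, 1]))\<^sup>2 * (\<Sum>m\<in>F. (cmod (green z 1 m))\<^sup>2) \<le> 20 * \<tau> ^ 4"
  proof (rule sum_columns_le[OF _ _ sums sums sums le(2) le(2)])
    fix m assume "m \<in> F"
    then have m: "m < n" by (rule F)
    have "vector [0, green z 1 m] = (vector [- green z 1 1 * green z m 1 + green z m 1 * green z 1 1,
        - green z 1 1 * green z m 0 + green z m 1 * green z 1 0] :: complex^2)"
      using W[OF m] sym[of m] by (simp add: vec_eq_iff forall_2 algebra_simps)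
    then show "cmod (green z 1 m) * norm (A *v vector [0, 1]) = norm (vector
        [- green z 1 1 * green z m (n + 1) + green z m 1 * green z 1 (n + 1),
         - green z 1 1 * green z m n + green z m 1 * green z 1 n] :: complex^2)"
      by (metis norm_mult_vector(1) propagate[OF m])
  qed (use le(1)[of 1 1] \<tau> in simp)
  have c1: "(norm (A *v vector [1, 0]))\<^sup>2 * (\<Sum>m\<in>F. (cmod (green z 1 m))\<^sup>2) \<le> 20 * \<tau> ^ 4"
  proof (rule sum_columns_le[OF _ _ sums sums sums' le(2) le(2)])
    fix m assume "m \<in> F"
    then have m: "m < n" by (rule F)
    have "vector [green z 1 m, 0] = (vector [green z 1 0 * green z m 1 + - green z m 0 * green z 1 1,
        green z 1 0 * green z m 0 + - green z m 0 * green z 1 0] :: complex^2)"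
      using W[OF m] sym[of m] by (simp add: vec_eq_iff forall_2 algebra_simps)
    then show "cmod (green z 1 m) * norm (A *v vector [1, 0]) = norm (vector
        [green z 1 0 * green z m (n + 1) + - green z m 0 * green z 1 (n + 1),
         green z 1 0 * green z m n + - green z m 0 * green z 1 n] :: complex^2)"
      by (metis norm_mult_vector(2) propagate[OF m])
  qed (use le(1)[of 1 0] \<tau> in simp)
  have "(op_norm A)\<^sup>2 * (\<Sum>m\<in>F. (cmod (green z 1 m))\<^sup>2)
      \<le> (2 * (norm (A *v vector [1, 0]))\<^sup>2 + 2 * (norm (A *v vector [0, 1]))\<^sup>2) * (\<Sum>m\<in>F. (cmod (green z 1 m))\<^sup>2)"
    by (intro mult_right_mono op_norm_square_le_columns sum_nonneg) simp
  also have "\<dots> \<le> 80 * \<tau> ^ 4"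
    using c1 c2 by (simp add: algebra_simps)
  finally show ?thesis by (simp add: A_def \<tau>_def)
qed

end

section \<open>Time-averaged probabilities\<close>

lemma bounded_linear_ell2_nth: "bounded_linear (\<lambda>f. ell2_nth f n)"
  by (rule bounded_linear_intro[of _ 1]) (auto simp: cmod_ell2_nth_le)

context schrodinger_operator begin

lemma resolvent_schrodinger:
  assumes z: "Im z > 0"
  shows "resolvent V z (schrodinger V f) = f + z *\<^sub>C resolvent V z f"
proof -
  have "resolvent V z (schrodinger V f) - resolvent V z (z *\<^sub>C f) = f"
    using resolvent_left[OF not_in_spectrum[OF z], of f] by (simp add: blinfun.diff_right)
  then show ?thesis
    by (simp add: resolvent_scaleC[OF z] algebra_simps)
qed

lemma evolution_nth_has_vector_derivative:
  "((\<lambda>t. ell2_nth (evolution V t f) n) has_vector_derivative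
    ell2_nth ((- \<i>) *\<^sub>C schrodinger V (evolution V t f)) n) (at t)"
  by (rule bounded_linear.has_vector_derivative[OF bounded_linear_ell2_nth evolution_has_vector_derivative])

lemma isCont_evolution_nth: "isCont (\<lambda>t. ell2_nth (evolution V t f) n) t"
  using evolution_nth_has_vector_derivative has_vector_derivative_continuous by blast

lemma borel_measurable_evolution_nth [measurable]:
  "(\<lambda>t. ell2_nth (evolution V t f) n) \<in> borel_measurable borel"
  by (intro borel_measurable_continuous_onI continuous_at_imp_continuous_on ballI isCont_evolution_nth)

text \<open>The rate 1/T is half of that in \<open>avg_prob\<close> because the modulus will be
  squared; the open half-line matches \<open>einterval 0 \<infinity>\<close>.\<close>

definition damped :: "real \<Rightarrow> int \<Rightarrow> real \<Rightarrow> complex"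
  where "damped T n t = indicator {0<..} t *\<^sub>R (exp (- t / T) *\<^sub>R ell2_nth (evolution V t (delta 1)) n)"

text \<open>Applying the resolvent to the evolved state yields an explicit antiderivative
  \<open>G\<close> of exp(izt) times the amplitude. It equals iG(n,1) at time 0 and is at most T
  exp(-t/T) in modulus, so the fundamental theorem evaluates the integral.\<close>

lemma fourier_evolution:
  fixes T E :: real and n :: int
  assumes T: "T > 0"
  defines "z \<equiv> complex_of_real E + \<i> / complex_of_real T"
  defines "f \<equiv> damped T n"
  shows "integrable lborel f"
    and "(\<integral>t. f t * iexp (E * t) \<partial>lborel) = - \<i> * green z 1 n"
    and "\<And>t. norm (f t) \<le> 1"
    and "AE t in lborel. isCont f t"
proof -
  have Imz: "Im z = 1 / T" and z: "Im z > 0" using T by (auto simp: z_def)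
  define g where "g = (\<lambda>t. ell2_nth (evolution V t (delta 1)) n)"
  define r where "r = (\<lambda>t. ell2_nth (resolvent V z (evolution V t (delta 1))) n)"
  define e where "e = (\<lambda>t. exp (\<i> * z * complex_of_real t))"
  define G where "G = (\<lambda>t. \<i> * (e t * r t))"
  have contg: "isCont g t" for t
    unfolding g_def by (rule isCont_evolution_nth)
  have [measurable]: "g \<in> borel_measurable borel"
    unfolding g_def by measurable
  have dr: "(r has_vector_derivative - \<i> * (g t + z * r t)) (at t)" for t
  proof -
    have "(r has_vector_derivative
        ell2_nth (resolvent V z ((- \<i>) *\<^sub>C schrodinger V (evolution V t (delta 1)))) n) (at t)"
      unfolding r_def
      by (intro bounded_linear.has_vector_derivative[OF bounded_linear_ell2_nth]
          bounded_linear.has_vector_derivative[OF blinfun.bounded_linear_right] evolution_has_vector_derivative)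
    then show ?thesis
      unfolding resolvent_scaleC[OF z] resolvent_schrodinger[OF z] by (simp add: r_def g_def)
  qed
  have de: "(e has_vector_derivative \<i> * z * e t) (at t)" for t
    unfolding e_def
    by (rule has_vector_derivative_real_field) (auto intro!: derivative_eq_intros)
  have dG: "(G has_vector_derivative e t * g t) (at t)" for t
  proof -
    have "(G has_vector_derivative \<i> * (e t * (- \<i> * (g t + z * r t)) + \<i> * z * e t * r t)) (at t)"
      unfolding G_def by (intro has_vector_derivative_mult_right has_vector_derivative_mult de dr)
    also have "\<i> * (e t * (- \<i> * (g t + z * r t)) + \<i> * z * e t * r t) = e t * g t"
      by (simp add: algebra_simps)
    finally show ?thesis .
  qed
  have norme: "cmod (e t) = exp (- t / T)" for t
    by (simp add: e_def Imz)
  have normg: "cmod (g t) \<le> 1" for t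
    unfolding g_def using cmod_ell2_nth_le[of "evolution V t (delta 1)" n] by (simp add: norm_evolution[OF V] norm_delta)
  have normr: "cmod (r t) \<le> T" for t
  proof -
    have "cmod (r t) \<le> norm (resolvent V z (evolution V t (delta 1)))"
      unfolding r_def by (rule cmod_ell2_nth_le)
    then show ?thesis
      using norm_resolvent_le_Im[OF z, of "evolution V t (delta 1)"] T
      by (simp add: Imz norm_evolution[OF V] norm_delta pos_divide_le_eq)
  qed
  have ef: "f t * iexp (E * t) = indicator {0<..} t *\<^sub>R (e t * g t)" for t
  proof -
    have "e t = exp (- t / T) *\<^sub>R iexp (E * t)"
      unfolding e_def z_def
      by (simp add: scaleR_conv_of_real exp_of_real[symmetric] algebra_simps flip: exp_add)
    then show ?thesis by (simp add: f_def damped_def g_def)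
  qed
  have f_alt: "f = (\<lambda>t. indicator {0<..} t *\<^sub>R (exp (- t / T) *\<^sub>R g t))"
    by (simp add: f_def damped_def g_def fun_eq_iff)
  have [measurable]: "f \<in> borel_measurable borel"
    unfolding f_alt by measurable
  have normf: "norm (f t) \<le> indicator {0<..} t * exp (- t / T)" for t
    unfolding f_alt using normg[of t] by (auto simp: indicator_def)
  have iexpT: "integrable lborel (\<lambda>t. indicator {0<..} t * exp (- t / T))"
  proof -
    have "set_integrable lborel {0<..} (\<lambda>x. exp (- (x * (1 / T))))"
      by (rule integrable_I0i_exp_mscale) (use T in simp)
    then show ?thesis by (simp add: set_integrable_def)
  qed
  show intf: "integrable lborel f"
    by (rule Bochner_Integration.integrable_bound[OF iexpT]) (use normf in auto)
  show "norm (f t) \<le> 1" for t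
    using normf[of t] T by (auto simp: indicator_def split: if_splits intro: order_trans)
  have "isCont f t" if "t \<noteq> 0" for t
  proof (cases "t > 0")
    case True
    have "isCont (\<lambda>t. exp (- t / T) *\<^sub>R g t) t"
      using T by (intro continuous_intros contg) auto
    moreover have "eventually (\<lambda>t. f t = exp (- t / T) *\<^sub>R g t) (nhds t)"
      using eventually_nhds_in_open[of "{0<..}" t] True
      by (auto elim!: eventually_mono simp: f_alt)
    ultimately show ?thesis by (simp add: isCont_cong)
  next
    case False
    have "eventually (\<lambda>t. f t = 0) (nhds t)"
      using eventually_nhds_in_open[of "{..<0}" t] False that
      by (auto elim!: eventually_mono simp: f_alt)
    then show ?thesis by (simp add: isCont_cong)
  qed
  then show "AE t in lborel. isCont f t"
    using AE_lborel_singleton[of 0] by (auto elim!: eventually_mono)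
  have "integrable lborel (\<lambda>t. indicator {0<..} t *\<^sub>R (e t * g t))"
    unfolding ef[symmetric]
    by (rule Bochner_Integration.integrable_bound[OF intf]) (auto simp: norm_mult)
  moreover have ei: "einterval 0 \<infinity> = {0<..}" by (auto simp: einterval_def)
  ultimately have si: "set_integrable lborel (einterval 0 \<infinity>) (\<lambda>t. e t * g t)"
    by (simp add: set_integrable_def)
  have contG: "isCont G t" for t using dG has_vector_derivative_continuous by blast
  have "(LBINT t=0..\<infinity>. e t * g t) = 0 - G 0"
  proof (rule interval_integral_FTC_integrable[OF _ _ _ si])
    show "(G has_vector_derivative e x * g x) (at x)" for x by (rule dG)
    show "isCont (\<lambda>t. e t * g t) x" for x
      unfolding e_def by (intro continuous_intros contg)
    show "((G \<circ> real_of_ereal) \<longlongrightarrow> G 0) (at_right 0)"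
      using contG[of 0] unfolding isCont_def zero_ereal_def
      by (simp add: ereal_tendsto_simps filterlim_at_split)
    have "((\<lambda>t. T * exp (- t / T)) \<longlongrightarrow> 0) at_top"
      using T by real_asymp
    then have "(G \<longlongrightarrow> 0) at_top"
      by (rule Lim_null_comparison[rotated])
        (use mult_right_mono[OF normr, of "exp (- _ / T)"] in \<open>auto simp: G_def norm_mult norme mult.commute\<close>)
    then show "((G \<circ> real_of_ereal) \<longlongrightarrow> 0) (at_left \<infinity>)"
      by (simp add: ereal_tendsto_simps)
  qed auto
  moreover have "(LBINT t=0..\<infinity>. e t * g t) = (\<integral>t. f t * iexp (E * t) \<partial>lborel)"
    unfolding ef by (simp add: interval_lebesgue_integral_def ei set_lebesgue_integral_def)
  moreover have "G 0 = \<i> * green z 1 n"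
    by (simp add: G_def e_def r_def evolution_0 green_def)
  ultimately show "(\<integral>t. f t * iexp (E * t) \<partial>lborel) = - \<i> * green z 1 n" by simp
qed

text \<open>The factor 1/(pi T) combines 2/T from the time average with 1/(2 pi) from
  Plancherel.\<close>

lemma avg_prob_le_green_integral:
  assumes T: "T > 0"
    and int: "integrable lborel (\<lambda>E. (cmod (green (complex_of_real E + \<i> / complex_of_real T) 1 n))\<^sup>2)"
  shows "avg_prob V n T
    \<le> (\<integral>E. (cmod (green (complex_of_real E + \<i> / complex_of_real T) 1 n))\<^sup>2 \<partial>lborel) / (pi * T)"
proof -
  define f where "f = damped T n"
  note F = fourier_evolution[OF T, of n, folded f_def]
  have [measurable]: "f \<in> borel_measurable borel" using F(1) by auto
  define I where "I = (\<integral>E. (cmod (green (complex_of_real E + \<i> / complex_of_real T) 1 n))\<^sup>2 \<partial>lborel)"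
  have "2 * pi * (\<integral>t. (norm (f t))\<^sup>2 \<partial>lborel)
      \<le> (\<integral>E. (norm (- \<i> * green (complex_of_real E + \<i> / complex_of_real T) 1 n))\<^sup>2 \<partial>lborel)"
    by (rule fourier_square_integral_ge[OF F(1) F(2)[symmetric] F(3) F(4)]) (use int in \<open>simp add: norm_mult\<close>)
  then have le: "2 * pi * (\<integral>t. (norm (f t))\<^sup>2 \<partial>lborel) \<le> I"
    by (simp add: I_def norm_mult)
  \<comment> \<open>The closed and the open half-line differ at t = 0 alone, a null set.\<close>
  have eq: "indicator {0..} t *\<^sub>R (exp (- 2 * t / T) * (cmod (cinner (evolution V t (delta 1)) (delta n)))\<^sup>2)
      = (norm (f t))\<^sup>2" if "t \<noteq> 0" for t
    using that
    by (auto simp: f_def damped_def indicator_def cinner_delta power_mult_distrib exp_double[symmetric])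
  have "(LBINT t:{0..}. exp (- 2 * t / T) * (cmod (cinner (evolution V t (delta 1)) (delta n)))\<^sup>2)
     = (\<integral>t. (norm (f t))\<^sup>2 \<partial>lborel)"
    unfolding set_lebesgue_integral_def
    by (rule integral_cong_AE) (use AE_lborel_singleton[of "0::real"] eq in \<open>auto elim!: eventually_mono simp: cinner_delta\<close>)
  then have "avg_prob V n T = 2 / T * (\<integral>t. (norm (f t))\<^sup>2 \<partial>lborel)"
    by (simp add: avg_prob_def)
  also have "\<dots> = (2 * pi * (\<integral>t. (norm (f t))\<^sup>2 \<partial>lborel)) / (pi * T)"
    using T by simp
  also have "\<dots> \<le> I / (pi * T)"
    using T le by (intro divide_right_mono) auto
  finally show ?thesis by (simp add: I_def)
qed
end

section \<open>Continuity of the transfer matrix norms\<close>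

lemma op_norm_diff_le: "\<bar>op_norm A - op_norm B\<bar> \<le> op_norm (A - B)"
proof -
  have lin: "bounded_linear (\<lambda>x. M *v x)" for M :: "complex^2^2" by simp
  have tri: "op_norm A \<le> op_norm (A - B) + op_norm B" for A B :: "complex^2^2"
  proof -
    have "(\<lambda>x. (A - B) *v x + B *v x) = (\<lambda>x. A *v x)"
      by (simp add: fun_eq_iff matrix_vector_mult_diff_rdistrib)
    then show ?thesis
      unfolding op_norm_def using onorm_triangle[OF lin[of "A - B"] lin[of B]] by simp
  qed
  have "op_norm (B - A) = op_norm (A - B)"
  proof -
    have "(\<lambda>x. - ((A - B) *v x)) = (\<lambda>x. (B - A) *v x)"
      by (simp add: fun_eq_iff matrix_vector_mult_diff_rdistrib)
    then show ?thesis
      unfolding op_norm_def using onorm_neg[of "\<lambda>x. (A - B) *v x"] by simp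
  qed
  then show ?thesis using tri[of A B] tri[of B A] by linarith
qed

lemma op_norm_le_norm: "op_norm A \<le> 2 * norm A"
proof -
  have "norm (A *v vector [1, 0]) \<le> norm A" "norm (A *v vector [0, 1]) \<le> norm A"
    unfolding norm_vec_def[of "A *v _"] norm_vec_def[of A]
    by (rule L2_set_mono; simp add: matrix_vector_mult_def sum_2 Finite_Cartesian_Product.norm_nth_le)+
  then show ?thesis using op_norm_le_columns[of A] by simp
qed

text \<open>The reverse triangle inequality gives Lipschitz constant 2. Continuity is wanted for
  measurability in E of the maximum over sites.\<close>

lemma continuous_op_norm: "continuous_on UNIV op_norm"
proof (rule uniformly_continuous_imp_continuous, unfold uniformly_continuous_on_def, intro allI impI)
  fix e :: real assume e: "0 < e"
  show "\<exists>d>0. \<forall>x\<in>UNIV. \<forall>x'\<in>UNIV. dist x' x < d \<longrightarrow> dist (op_norm x') (op_norm x) < e"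
  proof (intro exI[of _ "e / 2"] conjI ballI impI)
    fix x x' :: "complex^2^2" assume "dist x' x < e / 2"
    then show "dist (op_norm x') (op_norm x) < e"
      using op_norm_diff_le[of x' x] op_norm_le_norm[of "x' - x"] by (simp add: dist_norm)
  qed (use e in simp)
qed

lemma continuous_on_matrix_mult:
  fixes f g :: "'a::topological_space \<Rightarrow> complex^2^2"
  assumes "continuous_on S f" "continuous_on S g"
  shows "continuous_on S (\<lambda>x. f x ** g x)"
  unfolding matrix_matrix_mult_def sum_2
  by (intro continuous_intros assms)

lemma continuous_on_vec2:
  assumes "\<And>i j. continuous_on S (\<lambda>x. f x $ i $ j)"
  shows "continuous_on S (f :: 'a::topological_space \<Rightarrow> complex^2^2)"
proof -
  have "continuous_on S (\<lambda>x. \<chi> i j. f x $ i $ j)"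
    by (intro continuous_intros assms)
  then show ?thesis by simp
qed

lemma continuous_transfer_step: "continuous_on UNIV (transfer_step V m)"
proof (rule continuous_on_vec2)
  show "continuous_on UNIV (\<lambda>z. transfer_step V m z $ i $ j)" for i j
    using exhaust_2[of i] exhaust_2[of j] unfolding transfer_step_def
    by (elim disjE; simp add: continuous_on_diff)
qed

lemma continuous_inv_transfer_step: "continuous_on UNIV (\<lambda>z. matrix_inv (transfer_step V m z))"
  unfolding matrix_inv_transfer_step
proof (rule continuous_on_vec2)
  show "continuous_on UNIV (\<lambda>z. vector [vector [0, 1], vector [- 1, z - of_real (V m)]] $ i $ j :: complex)" for i j :: 2
    using exhaust_2[of i] exhaust_2[of j]
    by (elim disjE; simp add: continuous_on_diff)
qed

lemma continuous_transfer: "continuous_on UNIV (transfer V n)"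
proof -
  have "continuous_on UNIV (transfer_pos V k)" for k
    by (induction k) (auto intro!: continuous_on_matrix_mult continuous_transfer_step)
  moreover have "continuous_on UNIV (transfer_neg V k)" for k
    by (induction k) (auto intro!: continuous_on_matrix_mult continuous_inv_transfer_step)
  ultimately show ?thesis
    by (cases "n \<ge> 0") (auto simp: transfer_def[abs_def])
qed

lemma op_norm_ge_1:
  assumes "norm (A *v vector [1, 0 :: complex]) \<ge> 1"
  shows "op_norm A \<ge> 1"
proof -
  have "norm (vector [1, 0 :: complex] :: complex^2) = 1"
    by (simp add: norm_vec_def L2_set_def sum_2)
  then show ?thesis using norm_mult_le_op_norm[of A "vector [1, 0]"] assms by simp
qed

text \<open>The first basis vector is sent to (z - V(1), 1) and to (0, -1). Hence the maximum is at
  least 1 and its inverse is bounded, thus integrable over the window.\<close>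

lemma op_norm_transfer_ge_1: "op_norm (transfer V 1 z) \<ge> 1" "op_norm (transfer V (-1) z) \<ge> 1"
proof -
  have "(norm (transfer V 1 z *v vector [1, 0]))\<^sup>2 \<ge> 1\<^sup>2"
    by (simp add: transfer_def transfer_step_mult norm_vec2)
  then show "op_norm (transfer V 1 z) \<ge> 1"
    by (intro op_norm_ge_1) (use power2_le_imp_le norm_ge_zero in blast)
  have "(norm (transfer V (-1) z *v vector [1, 0]))\<^sup>2 \<ge> 1\<^sup>2"
    by (simp add: transfer_def matrix_inv_transfer_step_mult norm_vec2)
  then show "op_norm (transfer V (-1) z) \<ge> 1"
    by (intro op_norm_ge_1) (use power2_le_imp_le norm_ge_zero in blast)
qed

text \<open>With the set of sites as a parameter, one estimate serves both directions.\<close>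

definition transfer_max :: "(int \<Rightarrow> real) \<Rightarrow> int set \<Rightarrow> real \<Rightarrow> real \<Rightarrow> real"
  where "transfer_max V S T E
    = Max ((\<lambda>n. (op_norm (transfer V n (complex_of_real E + \<i> / complex_of_real T)))\<^sup>2) ` S)"

lemma transfer_max_ge_1:
  assumes "finite S" "1 \<in> S \<or> - 1 \<in> S"
  shows "transfer_max V S T E \<ge> 1"
proof -
  obtain n where n: "n \<in> S" "op_norm (transfer V n (complex_of_real E + \<i> / complex_of_real T)) \<ge> 1"
    using assms(2) op_norm_transfer_ge_1 by metis
  have "1 \<le> (op_norm (transfer V n (complex_of_real E + \<i> / complex_of_real T)))\<^sup>2"
    using n(2) by (simp add: power_le_one_iff one_le_power)
  also have "\<dots> \<le> transfer_max V S T E"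
    unfolding transfer_max_def using assms(1) n(1) by (intro Max_ge) auto
  finally show ?thesis .
qed

lemma borel_measurable_transfer_max:
  assumes "finite S" "S \<noteq> {}"
  shows "transfer_max V S T \<in> borel_measurable borel"
proof -
  have "(\<lambda>E. (op_norm (transfer V n (complex_of_real E + \<i> / complex_of_real T)))\<^sup>2) \<in> borel_measurable borel" for n
    by (intro borel_measurable_continuous_onI continuous_intros
        continuous_on_compose2[OF continuous_op_norm] continuous_on_compose2[OF continuous_transfer]) auto
  then show ?thesis
    unfolding transfer_max_def[abs_def] using assms by (intro borel_measurable_Max) auto
qed

lemma set_integrable_inverse_transfer_max:
  assumes "finite S" "1 \<in> S \<or> - 1 \<in> S"
  shows "set_integrable lborel {a..b} (\<lambda>E. inverse (transfer_max V S T E))"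
proof -
  have ne: "S \<noteq> {}" using assms(2) by auto
  note [measurable] = borel_measurable_transfer_max[OF assms(1) ne, of V T]
  have "set_integrable lborel {a..b} (\<lambda>E. 1 :: real)"
    by (rule borel_integrable_atLeastAtMost') simp
  then show ?thesis
    unfolding set_integrable_def
  proof (rule Bochner_Integration.integrable_bound)
    show "AE E in lborel. norm (indicat_real {a..b} E *\<^sub>R inverse (transfer_max V S T E))
        \<le> norm (indicat_real {a..b} E *\<^sub>R (1 :: real))"
    proof (intro AE_I2)
      fix E
      have "0 \<le> inverse (transfer_max V S T E)" "inverse (transfer_max V S T E) \<le> 1"
        using transfer_max_ge_1[OF assms, of V T E] by (auto simp: inverse_le_1_iff)
      then show "norm (indicat_real {a..b} E *\<^sub>R inverse (transfer_max V S T E))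
          \<le> norm (indicat_real {a..b} E *\<^sub>R (1 :: real))"
        by (auto simp: indicator_def)
    qed
  qed measurable
qed

lemma integrable_inverse_1_plus_square_line:
  "integrable lborel (\<lambda>x::real. inverse (1 + x\<^sup>2))"
  "(LBINT x. inverse (1 + x\<^sup>2)) = pi"
proof -
  have "einterval (-\<infinity>) \<infinity> = UNIV" by (auto simp: einterval_def)
  then show "integrable lborel (\<lambda>x::real. inverse (1 + x\<^sup>2))" "(LBINT x. inverse (1 + x\<^sup>2)) = pi"
    using integrable_inverse_1_plus_square LBINT_inverse_1_plus_square
    by (simp_all add: set_integrable_def interval_lebesgue_integral_def set_lebesgue_integral_def)
qed

section \<open>The upper bound\<close>

context schrodinger_operator begin

text \<open>Left and right tails enter only through \<open>inner\<close> and \<open>outer\<close>.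
  One integrable majorant \<open>bd\<close> covers all energies: its first summand handles |E| <= K,
  its second |E| > K.\<close>

lemma sum_avg_prob_le:
  assumes T: "T \<ge> 1" and K2: "K \<ge> 2" and N: "N \<ge> 1"
    and S: "finite S" "1 \<in> S \<or> - 1 \<in> S" and F: "finite F"
    and inner: "\<And>n z. n \<in> S \<Longrightarrow> 0 < Im z \<Longrightarrow> Im z \<le> 1 \<Longrightarrow>
      (op_norm (transfer V n z))\<^sup>2 * (\<Sum>m\<in>F. (cmod (green z 1 m))\<^sup>2) \<le> 80 * (1 / Im z) ^ 4"
    and outer: "\<And>n. n \<in> F \<Longrightarrow> \<bar>n - 1\<bar> \<ge> N"
  shows "(\<Sum>n\<in>F. avg_prob V n T) \<le> (80 + 2 * K\<^sup>2) *
    (exp (- (2 * ln (K / (K - 1))) * real_of_int N) + T ^ 3 * (LBINT E:{-K..K}. inverse (transfer_max V S T E)))"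
proof -
  define z where "z = (\<lambda>E. complex_of_real E + \<i> / complex_of_real T)"
  have Imz: "Im (z E) = 1 / T" and Rez: "Re (z E) = E" for E using T by (auto simp: z_def)
  have z0: "0 < Im (z E)" and z1: "Im (z E) \<le> 1" for E using T by (auto simp: Imz)
  define q where "q = (K - 1) / K"
  have q: "0 < q" "q < 1" using K2 by (auto simp: q_def)
  define \<epsilon> where "\<epsilon> = (q ^ nat N)\<^sup>2"
  \<comment> \<open>Squaring the Neumann remainder gives q^(2N), which explains the 2 in the
    exponential rate.\<close>
  have \<epsilon>_eq: "\<epsilon> = exp (- (2 * ln (K / (K - 1))) * real_of_int N)"
  proof -
    have "ln (K / (K - 1)) = - ln q" using K2 by (simp add: q_def ln_div)
    then have "exp (- (2 * ln (K / (K - 1))) * real_of_int N) = exp (real (2 * nat N) * ln q)"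
      using N by (simp add: mult_ac)
    also have "\<dots> = q ^ (2 * nat N)" using q by (simp only: exp_of_nat_mult exp_ln)
    finally show ?thesis by (simp add: \<epsilon>_def power_mult[symmetric] mult.commute)
  qed
  define s where "s = (\<lambda>E. \<Sum>m\<in>F. (cmod (green (z E) 1 m))\<^sup>2)"
  define M where "M = transfer_max V S T"
  define bd where "bd = (\<lambda>E. 80 * T ^ 4 * (indicator {-K..K} E *\<^sub>R inverse (M E)) + 2 * K\<^sup>2 * \<epsilon> * inverse (1 + E\<^sup>2))"
  have s0: "s E \<ge> 0" for E by (simp add: s_def sum_nonneg)
  have M1: "M E \<ge> 1" for E unfolding M_def by (rule transfer_max_ge_1[OF S])
  have s_bd: "s E \<le> bd E" for E
  proof (cases "\<bar>E\<bar> \<le> K")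
    case True
    \<comment> \<open>The maximum is attained at a site depending on E, and the transfer estimate is
      applied at that site.\<close>
    have "M E \<in> (\<lambda>n. (op_norm (transfer V n (z E)))\<^sup>2) ` S"
      unfolding M_def transfer_max_def z_def using S by (intro Max_in) auto
    then obtain n where n: "n \<in> S" "M E = (op_norm (transfer V n (z E)))\<^sup>2" by auto
    have "M E * s E \<le> 80 * T ^ 4"
      using inner[OF n(1) z0 z1, of E] n(2) by (simp add: s_def Imz)
    then have "s E \<le> 80 * T ^ 4 * inverse (M E)"
      using M1[of E] by (simp add: field_simps)
    moreover have "0 \<le> 2 * K\<^sup>2 * \<epsilon> * inverse (1 + E\<^sup>2)"
      by (simp add: \<epsilon>_def)
    moreover have "bd E = 80 * T ^ 4 * inverse (M E) + 2 * K\<^sup>2 * \<epsilon> * inverse (1 + E\<^sup>2)"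
      using True by (simp add: bd_def abs_le_iff)
    ultimately show ?thesis by linarith
  next
    case False
    define r where "r = cmod (z E)"
    have rE: "r \<ge> \<bar>E\<bar>" using abs_Re_le_cmod[of "z E"] by (simp add: r_def Rez)
    have rK: "r > K" using rE False by simp
    have "s E \<le> (((K - 1) / r) ^ nat N / (r - (K - 1)))\<^sup>2"
      unfolding s_def r_def
      by (rule sum_green_tail_le[OF z0 _ F]) (use rK outer N in \<open>auto simp: r_def\<close>)
    also have "\<dots> \<le> (q ^ nat N * (K / \<bar>E\<bar>))\<^sup>2"
    proof (rule power_mono)
      have "((K - 1) / r) ^ nat N \<le> q ^ nat N"
        unfolding q_def using rK K2 by (intro power_mono divide_left_mono) auto
      \<comment> \<open>With |E| in place of r the claim amounts to |E| >= K, with equality at |E| =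
        K; enlarging r only helps.\<close>
      moreover have "1 / (r - (K - 1)) \<le> K / \<bar>E\<bar>"
      proof -
        have "(K - 1) * (K - 1) \<le> (K - 1) * \<bar>E\<bar> - (K - 1)" 
          using mult_left_mono[of K "\<bar>E\<bar>" "K - 1"] False K2 by (simp add: algebra_simps)
        then have "\<bar>E\<bar> \<le> K * (\<bar>E\<bar> - (K - 1))" using K2 by (simp add: algebra_simps)
        also have "\<dots> \<le> K * (r - (K - 1))" using rE K2 by (intro mult_left_mono) auto
        finally show ?thesis using rK False K2 by (simp add: divide_simps)
      qed
      ultimately have "((K - 1) / r) ^ nat N * (1 / (r - (K - 1))) \<le> q ^ nat N * (K / \<bar>E\<bar>)"
        using rK K2 q by (intro mult_mono) auto
      then show "((K - 1) / r) ^ nat N / (r - (K - 1)) \<le> q ^ nat N * (K / \<bar>E\<bar>)" by simp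
    qed (use rK K2 in auto)
    also have "\<dots> = \<epsilon> * K\<^sup>2 / E\<^sup>2"
      by (simp add: \<epsilon>_def power_mult_distrib power_divide)
    \<comment> \<open>Since |E| >= 1, this replaces 1/E^2 by a function integrable over the whole
      line, with integral pi.\<close>
    also have "\<dots> \<le> \<epsilon> * K\<^sup>2 * (2 * inverse (1 + E\<^sup>2))"
    proof -
      have "1 \<le> \<bar>E\<bar>" using False K2 by simp
      then have "1 \<le> E\<^sup>2" using power_mono[of 1 "\<bar>E\<bar>" 2] by simp
      moreover from this have "0 < E\<^sup>2" by linarith
      ultimately have "1 / E\<^sup>2 \<le> 2 * inverse (1 + E\<^sup>2)"
        by (simp add: pos_divide_le_eq pos_le_divide_eq inverse_eq_divide add_pos_pos distrib_left)
      from mult_left_mono[OF this, of "\<epsilon> * K\<^sup>2"] show ?thesis by (simp add: \<epsilon>_def)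
    qed
    finally have "s E \<le> \<epsilon> * K\<^sup>2 * (2 * inverse (1 + E\<^sup>2))" .
    moreover have "E \<notin> {-K..K}" using False by (simp add: abs_le_iff) linarith
    ultimately show ?thesis by (simp add: bd_def mult_ac)
  qed
  have bd_int: "integrable lborel bd"
    unfolding bd_def M_def
    using set_integrable_inverse_transfer_max[OF S, of "-K" K V T]
    by (intro Bochner_Integration.integrable_add integrable_mult_right integrable_inverse_1_plus_square_line)
      (auto simp: set_integrable_def)
  \<comment> \<open>Measurability in E is read off from the Fourier representation of G, a parameter
    integral.\<close>
  have green_meas: "(\<lambda>E. (cmod (green (z E) 1 n))\<^sup>2) \<in> borel_measurable borel" for n
  proof -
    have "(\<lambda>E. \<integral>t. damped T n t * iexp (E * t) \<partial>lborel) \<in> borel_measurable borel"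
    proof -
      have [measurable]: "damped T n \<in> borel_measurable borel"
        using fourier_evolution(1)[of T n] T by auto
      show ?thesis by measurable
    qed
    then have "(\<lambda>E. (cmod (\<integral>t. damped T n t * iexp (E * t) \<partial>lborel))\<^sup>2) \<in> borel_measurable borel"
      by measurable
    moreover have "(\<integral>t. damped T n t * iexp (E * t) \<partial>lborel) = - \<i> * green (z E) 1 n" for E
      unfolding z_def by (rule fourier_evolution(2)) (use T in simp)
    ultimately show ?thesis
      by (simp only: norm_mult norm_minus_cancel norm_ii mult_1)
  qed
  have green_int: "integrable lborel (\<lambda>E. (cmod (green (z E) 1 n))\<^sup>2)" if "n \<in> F" for n
  proof (rule Bochner_Integration.integrable_bound[OF bd_int])
    have "(cmod (green (z E) 1 n))\<^sup>2 \<le> s E" for E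
      unfolding s_def by (rule member_le_sum) (use that F in auto)
    then show "AE E in lborel. norm ((cmod (green (z E) 1 n))\<^sup>2) \<le> norm (bd E)"
      using s_bd by (intro AE_I2) (smt (verit) norm_ge_zero real_norm_def zero_le_power2)
  qed (use green_meas in simp)
  have "(\<Sum>n\<in>F. avg_prob V n T) \<le> (\<Sum>n\<in>F. (\<integral>E. (cmod (green (z E) 1 n))\<^sup>2 \<partial>lborel) / (pi * T))"
    unfolding z_def using T green_int
    by (intro sum_mono avg_prob_le_green_integral) (auto simp: z_def)
  also have "\<dots> = (\<integral>E. s E \<partial>lborel) / (pi * T)"
    unfolding s_def by (subst Bochner_Integration.integral_sum) (auto intro: green_int simp: sum_divide_distrib)
  also have "\<dots> \<le> (\<integral>E. bd E \<partial>lborel) / (pi * T)"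
    using T s_bd bd_int by (intro divide_right_mono integral_mono')
      (auto simp: order_trans[OF s0 s_bd])
  also have "(\<integral>E. bd E \<partial>lborel) = 80 * T ^ 4 * (LBINT E:{-K..K}. inverse (M E)) + 2 * K\<^sup>2 * \<epsilon> * pi"
    unfolding bd_def set_lebesgue_integral_def
    using set_integrable_inverse_transfer_max[OF S, of "-K" K V T]
    by (subst Bochner_Integration.integral_add)
      (auto simp: set_integrable_def M_def integrable_inverse_1_plus_square_line)
  also have "\<dots> / (pi * T) = 80 * T ^ 3 * (LBINT E:{-K..K}. inverse (M E)) / pi + 2 * K\<^sup>2 * \<epsilon> / T"
    using T by (simp add: field_simps power_numeral_reduce)
  also have "\<dots> \<le> (80 + 2 * K\<^sup>2) * (T ^ 3 * (LBINT E:{-K..K}. inverse (M E))) + (80 + 2 * K\<^sup>2) * \<epsilon>"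
  proof (rule add_mono)
    have I0: "0 \<le> T ^ 3 * (LBINT E:{-K..K}. inverse (M E))"
    proof -
      have "0 \<le> inverse (M E)" for E using M1[of E] by simp
      then show ?thesis
        unfolding set_lebesgue_integral_def using T
        by (intro mult_nonneg_nonneg integral_nonneg_AE AE_I2) simp_all
    qed
    have "80 * T ^ 3 * (LBINT E:{-K..K}. inverse (M E)) / pi \<le> 80 * T ^ 3 * (LBINT E:{-K..K}. inverse (M E)) / 1"
      using I0 pi_ge_two by (intro divide_left_mono) auto
    also have "\<dots> \<le> (80 + 2 * K\<^sup>2) * (T ^ 3 * (LBINT E:{-K..K}. inverse (M E)))"
      using I0 by (simp add: algebra_simps)
    finally show "80 * T ^ 3 * (LBINT E:{-K..K}. inverse (M E)) / pi
        \<le> (80 + 2 * K\<^sup>2) * (T ^ 3 * (LBINT E:{-K..K}. inverse (M E)))" .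
    have e0: "0 \<le> \<epsilon>" by (simp add: \<epsilon>_def)
    have "2 * K\<^sup>2 * \<epsilon> / T \<le> 2 * K\<^sup>2 * \<epsilon> / 1"
      using T e0 by (intro divide_left_mono) auto
    also have "\<dots> \<le> (80 + 2 * K\<^sup>2) * \<epsilon>" using e0 by (simp add: algebra_simps)
    finally show "2 * K\<^sup>2 * \<epsilon> / T \<le> (80 + 2 * K\<^sup>2) * \<epsilon>" .
  qed
  finally show ?thesis
    unfolding \<epsilon>_eq M_def by (simp only: distrib_left add.commute)
qed

end

text \<open>If the family is not summable, \<open>infsum\<close> is 0 by default, and the bound for
  the empty set shows B >= 0.\<close>

lemma infsum_le_of_finite_sums:
  fixes f :: "'a \<Rightarrow> real"
  assumes "\<And>F. finite F \<Longrightarrow> F \<subseteq> A \<Longrightarrow> sum f F \<le> B" 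
  shows "infsum f A \<le> B"
proof (cases "f summable_on A")
  case True
  then show ?thesis by (rule infsum_le_finite_sums) (rule assms)
next
  case False
  then show ?thesis using assms[of "{}"] by (simp add: infsum_not_exists)
qed

theorem theorem7:
  fixes K :: real
  assumes "K \<ge> 4"
  shows "\<exists>C c :: real. C > 0 \<and> c > 0 \<and>
    (\<forall>V :: int \<Rightarrow> real. bounded (range V) \<longrightarrow>
      op_spectrum (schrodinger V) \<subseteq> complex_of_real ` {- K + 1 .. K - 1} \<longrightarrow>
      (\<forall>(N::int) (T::real). N \<ge> 1 \<longrightarrow> T \<ge> 1 \<longrightarrow>
        P_right V N T \<le> C * (exp (- c * real_of_int N) + T ^ 3 *
          (LBINT E:{-K..K}.
            inverse (Max ((\<lambda>n. (op_norm (transfer V n (complex_of_real E + \<i> / complex_of_real T)))\<^sup>2) ` {1..N})))) \<and>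
        P_left V N T \<le> C * (exp (- c * real_of_int N) + T ^ 3 *
          (LBINT E:{-K..K}.
            inverse (Max ((\<lambda>n. (op_norm (transfer V n (complex_of_real E + \<i> / complex_of_real T)))\<^sup>2) ` {-N..-1}))))))"
proof (rule exI[of _ "80 + 2 * K\<^sup>2"], rule exI[of _ "2 * ln (K / (K - 1))"], intro conjI allI impI)
  \<comment> \<open>In C, 80 is the constant of the transfer matrix estimate and
    \<open>2 * K\<^sup>2\<close> comes from the energies beyond K.\<close>
  show "80 + 2 * K\<^sup>2 > 0" by (simp add: add_pos_nonneg)
  show "2 * ln (K / (K - 1)) > 0" using assms by simp
  fix V :: "int \<Rightarrow> real" and N :: int and T :: real
  assume V: "bounded (range V)" and spec: "op_spectrum (schrodinger V) \<subseteq> complex_of_real ` {- K + 1 .. K - 1}"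
    and N: "N \<ge> 1" and T: "T \<ge> 1"
  interpret schrodinger_operator V K by unfold_locales (use assms V spec in auto)
  show "P_right V N T \<le> (80 + 2 * K\<^sup>2) * (exp (- (2 * ln (K / (K - 1))) * real_of_int N) + T ^ 3 *
      (LBINT E:{-K..K}.
        inverse (Max ((\<lambda>n. (op_norm (transfer V n (complex_of_real E + \<i> / complex_of_real T)))\<^sup>2) ` {1..N}))))"
    unfolding P_right_def transfer_max_def[symmetric]
  proof (rule infsum_le_of_finite_sums)
    fix F assume F: "finite F" "F \<subseteq> {N<..}"
    show "(\<Sum>n\<in>F. avg_prob V n T) \<le> (80 + 2 * K\<^sup>2) *
        (exp (- (2 * ln (K / (K - 1))) * real_of_int N) + T ^ 3 * (LBINT E:{-K..K}. inverse (transfer_max V {1..N} T E)))"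
    proof (rule sum_avg_prob_le[OF T _ N _ _ F(1)])
      fix n z assume "n \<in> {1..N}" "0 < Im z" "Im z \<le> 1"
      then show "(op_norm (transfer V n z))\<^sup>2 * (\<Sum>m\<in>F. (cmod (green z 1 m))\<^sup>2) \<le> 80 * (1 / Im z) ^ 4"
        by (intro sum_green_right_le F(1)) (use F(2) in auto)
    qed (use F(2) N assms in auto)
  qed
  show "P_left V N T \<le> (80 + 2 * K\<^sup>2) * (exp (- (2 * ln (K / (K - 1))) * real_of_int N) + T ^ 3 *
      (LBINT E:{-K..K}.
        inverse (Max ((\<lambda>n. (op_norm (transfer V n (complex_of_real E + \<i> / complex_of_real T)))\<^sup>2) ` {-N..-1}))))"
    unfolding P_left_def transfer_max_def[symmetric]
  proof (rule infsum_le_of_finite_sums)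
    fix F assume F: "finite F" "F \<subseteq> {..<-N}"
    show "(\<Sum>n\<in>F. avg_prob V n T) \<le> (80 + 2 * K\<^sup>2) *
        (exp (- (2 * ln (K / (K - 1))) * real_of_int N) + T ^ 3 * (LBINT E:{-K..K}. inverse (transfer_max V {-N..-1} T E)))"
    proof (rule sum_avg_prob_le[OF T _ N _ _ F(1)])
      fix n z assume "n \<in> {-N..-1}" "0 < Im z" "Im z \<le> 1"
      then show "(op_norm (transfer V n z))\<^sup>2 * (\<Sum>m\<in>F. (cmod (green z 1 m))\<^sup>2) \<le> 80 * (1 / Im z) ^ 4"
        by (intro sum_green_left_le F(1)) (use F(2) in auto)
    qed (use F(2) N assms in auto)
  qed
qed

end
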